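(* For all sufficiently large $H$, there are $O(H^{4.82})$ monic, irreducible, solvable sextic polynomials with integer coefficients in $[-H,H]$.
   Context: $H$ is a large positive real number. Irreducible means irreducible over $\mathbb{Q}$, and a polynomial is solvable if it is solvable by radicals, equivalently if its Galois group over $\mathbb{Q}$ is a solvable group. The implied constant is absolute. *)

theory Defs
  imports
    "HOL-Algebra.Solvable_Groups"
    "HOL-Algebra.Generated_Fields"
    "HOL-Algebra.Bij"
    "HOL-Algebra.Algebraic_Closure_Type"
    "HOL-Library.Landau_Symbols"
    Complex_Main
    "HOL-Computational_Algebra.Polynomial"
    "HOL-Computational_Algebra.Factorial_Ring"
begin

abbreviation complex_field :: "complex ring" where
  "complex_field \<equiv> ring_of_type_algebra"

definition splitting_field :: "rat poly \<Rightarrow> complex set" where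
  "splitting_field p =
     generate_field complex_field {z. poly (map_poly of_rat p) z = 0}"

text \<open>
  The automorphisms are taken in \<^const>\<open>extensional\<close> form, that is, as functions on
  the splitting field alone (\<^const>\<open>undefined\<close> outside it), and the group operation is the
  composition inherited from \<^const>\<open>BijGroup\<close>.
\<close>

definition galois_group :: "rat poly \<Rightarrow> (complex \<Rightarrow> complex) monoid" where
  "galois_group p =
     (let K = splitting_field p; L = complex_field\<lparr>carrier := K\<rparr>
      in BijGroup K\<lparr>carrier :=
           {\<sigma> \<in> ring_iso L L \<inter> extensional K. \<forall>q\<in>\<rat>. \<sigma> q = q}\<rparr>)"

text \<open>
  Solvability of a polynomial is the solvability of its Galois group over the rationals
  (equivalently, by Galois' theorem, solvability by radicals).
\<close>

definition solvable_poly :: "rat poly \<Rightarrow> bool" where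
  "solvable_poly p \<longleftrightarrow> solvable (galois_group p)"

definition solvable_sextics :: "real \<Rightarrow> int poly set" where
  "solvable_sextics H =
     {f. degree f = 6 \<and> lead_coeff f = 1 \<and>
         irreducible (map_poly rat_of_int f) \<and>
         solvable_poly (map_poly rat_of_int f) \<and>
         (\<forall>i. real_of_int (coeff f i) \<in> {-H..H})}"

lemma finite_solvable_sextics: "finite (solvable_sextics H)"
proof -
  define B where "B = {-\<lfloor>H\<rfloor>..\<lfloor>H\<rfloor>}"
  have "solvable_sextics H \<subseteq> Poly ` {xs. set xs \<subseteq> B \<and> length xs = 7}"
  proof
    fix f assume f: "f \<in> solvable_sextics H"
    have "f = Poly (coeffs f)" by simp
    moreover have "length (coeffs f) = 7"
      using f length_coeffs_degree[of f] by (cases "f = 0") (auto simp: solvable_sextics_def)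
    moreover have "set (coeffs f) \<subseteq> B"
    proof
      fix a assume "a \<in> set (coeffs f)"
      then obtain i where "a = coeff f i"
        by (auto simp: coeffs_def split: if_splits)
      then have "real_of_int a \<le> H" "- H \<le> real_of_int a"
        using f by (auto simp: solvable_sextics_def)
      then show "a \<in> B" unfolding B_def by (simp; linarith)
    qed
    ultimately show "f \<in> Poly ` {xs. set xs \<subseteq> B \<and> length xs = 7}" by blast
  qed
  moreover have "finite {xs. set xs \<subseteq> B \<and> length xs = 7}"
    by (rule finite_lists_length_eq) (simp add: B_def)
  ultimately show ?thesis by (meson finite_imageI finite_subset)
qed

lemma subfield_splitting_field: "subfield (splitting_field p) complex_field"
proof -
  interpret field complex_field by (rule field_from_type_algebra)
  show ?thesis unfolding splitting_field_def
    by (rule generate_field_is_subfield) (simp add: ring_of_type_algebra_def)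
qed

lemma Rats_subset_splitting_field: "\<rat> \<subseteq> splitting_field p"
proof -
  let ?K = "splitting_field p"
  let ?C = "complex_field"
  interpret R: field ?C by (rule field_from_type_algebra)
  have sel: "\<one>\<^bsub>?C\<^esub> = 1" "\<zero>\<^bsub>?C\<^esub> = 0" "carrier ?C = UNIV"
    "\<And>x y. x \<oplus>\<^bsub>?C\<^esub> y = x + y" "\<And>x y. x \<otimes>\<^bsub>?C\<^esub> y = x * y"
    by (simp_all add: ring_of_type_algebra_def)
  have one: "1 \<in> ?K"
    using generate_field.one[of ?C] by (simp add: splitting_field_def sel)
  have add: "x + y \<in> ?K" if "x \<in> ?K" "y \<in> ?K" for x y
    using generate_field.eng_add[of x ?C _ y] that by (simp add: splitting_field_def sel)
  have mult: "x * y \<in> ?K" if "x \<in> ?K" "y \<in> ?K" for x y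
    using generate_field.eng_mult[of x ?C _ y] that by (simp add: splitting_field_def sel)
  have uminus: "- x \<in> ?K" if "x \<in> ?K" for x
  proof -
    have "\<ominus>\<^bsub>?C\<^esub> x = - x" by (rule R.minus_equality) (simp_all add: sel)
    then show ?thesis
      using generate_field.a_inv[of x ?C] that by (simp add: splitting_field_def)
  qed
  have inverse: "inverse x \<in> ?K" if "x \<in> ?K" "x \<noteq> 0" for x
  proof -
    have "inv\<^bsub>?C\<^esub> x = inverse x"
      by (rule R.comm_inv_char) (use that in \<open>simp_all add: sel\<close>)
    then show ?thesis
      using generate_field.m_inv[of x ?C] that by (simp add: splitting_field_def sel)
  qed
  have zero: "0 \<in> ?K" using add[OF one uminus[OF one]] by simp
  have nat: "of_nat n \<in> ?K" for n by (induction n) (simp_all add: zero one add)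
  have int: "of_int k \<in> ?K" for k
    by (cases k rule: int_cases2) (simp_all add: nat uminus)
  show ?thesis
  proof
    fix x :: complex assume "x \<in> \<rat>"
    then obtain a b :: int where "b > 0" "x = of_int a / of_int b"
      by (rule Rats_cases')
    then show "x \<in> ?K"
      using mult[OF int[of a] inverse[OF int[of b]]] by (simp add: divide_inverse)
  qed
qed

lemma group_galois_group: "group (galois_group p)"
proof -
  define K where "K = splitting_field p"
  define L where "L = complex_field\<lparr>carrier := K\<rparr>"
  define A where "A = {\<sigma> \<in> ring_iso L L \<inter> extensional K. \<forall>q\<in>\<rat>. \<sigma> q = q}"
  interpret L: field L
    unfolding L_def K_def
    by (rule ring.subfield_iff(2)[OF field.is_ring[OF field_from_type_algebra]
          subfield_splitting_field])
  have QK: "\<rat> \<subseteq> K" unfolding K_def by (rule Rats_subset_splitting_field)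
  have cL: "carrier L = K" by (simp add: L_def)
  have AB: "A \<subseteq> Bij K" by (auto simp: A_def Bij_def ring_iso_def cL)
  have mult: "x \<otimes>\<^bsub>BijGroup K\<^esub> y = compose K x y" if "x \<in> A" "y \<in> A" for x y
    using AB that by (auto simp: BijGroup_def)
  have "subgroup A (BijGroup K)"
  proof (rule subgroup.intro)
    show "A \<subseteq> carrier (BijGroup K)" using AB by (simp add: BijGroup_def)
  next
    fix x y assume xy: "x \<in> A" "y \<in> A"
    have "compose K x y \<in> Bij K" using xy AB by (blast intro: compose_Bij)
    moreover have "compose K x y \<in> ring_hom L L"
    proof -
      have h: "x \<in> ring_hom L L" "y \<in> ring_hom L L" using xy by (auto simp: A_def ring_iso_def)
      then have "x \<circ> y \<in> ring_hom L L" by (rule ring_hom_trans[rotated])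
      then show ?thesis
        using L.ring_hom_restrict[of "x \<circ> y" L "compose K x y"]
        by (simp add: compose_def cL)
    qed
    moreover have "compose K x y q = q" if "q \<in> \<rat>" for q
      using that xy QK by (auto simp: A_def compose_def)
    ultimately show "x \<otimes>\<^bsub>BijGroup K\<^esub> y \<in> A"
      unfolding mult[OF xy] by (auto simp: A_def ring_iso_def Bij_def cL)
  next
    have "(\<lambda>z\<in>K. z) \<in> ring_hom L L"
      by (rule L.ring_hom_restrict[OF id_ring_hom]) (simp add: cL)
    then show "\<one>\<^bsub>BijGroup K\<^esub> \<in> A"
      using QK id_Bij[of K] by (auto simp: BijGroup_def A_def ring_iso_def Bij_def cL)
  next
    fix x assume x: "x \<in> A"
    define y where "y = (\<lambda>z\<in>K. inv_into K x z)"
    have xB: "x \<in> Bij K" using x AB by auto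
    then have bij: "bij_betw x K K" by (simp add: Bij_def)
    have yB: "y \<in> Bij K" unfolding y_def using xB by (rule restrict_inv_into_Bij)
    then have yK: "y z \<in> K" if "z \<in> K" for z
      using that Bij_imp_funcset by blast
    have xy: "x (y z) = z" if "z \<in> K" for z
      using that bij by (simp add: y_def bij_betw_inv_into_right)
    have inj: "u = v" if "x u = x v" "u \<in> K" "v \<in> K" for u v
      using bij that by (auto simp: bij_betw_def inj_on_def)
    have h: "x \<in> ring_hom L L" using x by (simp add: A_def ring_iso_def)
    have "y \<in> ring_hom L L"
    proof (rule ring_hom_memI)
      show "y a \<in> carrier L" if "a \<in> carrier L" for a using that yK by (simp add: cL)
      show "y (a \<otimes>\<^bsub>L\<^esub> b) = y a \<otimes>\<^bsub>L\<^esub> y b" if "a \<in> carrier L" "b \<in> carrier L" for a b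
        using that L.m_closed[of a b] L.m_closed[of "y a" "y b"] ring_hom_mult[OF h, of "y a" "y b"]
        by - (rule inj; simp add: cL xy yK)
      show "y (a \<oplus>\<^bsub>L\<^esub> b) = y a \<oplus>\<^bsub>L\<^esub> y b" if "a \<in> carrier L" "b \<in> carrier L" for a b
        using that L.a_closed[of a b] L.a_closed[of "y a" "y b"] ring_hom_add[OF h, of "y a" "y b"]
        by - (rule inj; simp add: cL xy yK)
      show "y \<one>\<^bsub>L\<^esub> = \<one>\<^bsub>L\<^esub>"
        using L.one_closed ring_hom_one[OF h] by - (rule inj; simp add: cL xy yK)
    qed
    moreover have "y q = q" if "q \<in> \<rat>" for q
      using that x QK by - (rule inj; auto simp: A_def xy yK)
    ultimately have "y \<in> A" using yB by (auto simp: A_def ring_iso_def Bij_def cL)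
    then show "inv\<^bsub>BijGroup K\<^esub> x \<in> A" using inv_BijGroup[OF xB] by (simp add: y_def)
  qed
  then have "group (BijGroup K\<lparr>carrier := A\<rparr>)"
    by (rule subgroup.subgroup_is_group) (rule group_BijGroup)
  then show ?thesis
    by (simp add: galois_group_def Let_def A_def L_def K_def)
qed

end

(*
  The root field of an irreducible solvable sextic f has a quadratic or a cubic subfield: the last
  nontrivial term of the derived series of the Galois group is abelian and normal, and its orbits
  (or those of its elements of order at most 2) are blocks of size e = 2 or 3. Hence f is a product
  of m = 6/e conjugate polynomials of degree e over a field of degree m, with algebraic integer
  coefficients. Landau's inequality bounds the product, over the m places, of the sizes of these
  coefficients by O(H). One coefficient alpha generates the field, and its minimal polynomial leaves
  O(H^m) choices. For fixed alpha and sizes rounded to powers of 2, each other coefficient is an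
  integer of the field in a box of volume O(H), and the difference of two such integers has norm at
  least 1, so there are O(H) choices by the pigeonhole principle. In both cases m + e - 1 = 4, which
  gives O(H^4 (log H)^3).
*)

theory Submission
  imports
    Defs
    "HOL-Algebra.Sylow"
    "HOL-Real_Asymp.Real_Asymp"
    "Jordan_Normal_Form.Char_Poly"
    "Berlekamp_Zassenhaus.Mahler_Measure"
begin

section \<open>Algebraic integers\<close>

text \<open>A solvable primitive group has prime power degree, so degree six forces blocks; only
  this instance is needed, and orbits of normal subgroups suffice for it. The field attached to the
  blocks varies with f, so no bound may depend on its discriminant or on an integral basis. For this
  reason a field integer is handled only through its tuple of conjugates, a function on the
  conjugates of alpha that is given by a rational polynomial, and the only arithmetic input is the
  lower bound for norms. Landau's inequality controls the product over the places but not the single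
  sizes, which may be very unequal. The boxes therefore need individual side lengths, and these have
  to be taken from a short list. The gain lies in counting the remaining coefficients inside the
  field that alpha has already fixed. Counting each of them through its own minimal polynomial, like
  alpha, would cost H^m per coefficient and H^(me) = H^6 in total, which is the trivial
  bound.\<close>

definition zspan :: "('i \<Rightarrow> complex) \<Rightarrow> 'i set \<Rightarrow> complex set" where
  "zspan v I = range (\<lambda>c :: 'i \<Rightarrow> int. \<Sum>i\<in>I. of_int (c i) * v i)"

lemma zspanI: "x = (\<Sum>i\<in>I. of_int (c i) * v i) \<Longrightarrow> x \<in> zspan v I"
  unfolding zspan_def by blast

lemma zspan_base: "finite I \<Longrightarrow> i \<in> I \<Longrightarrow> v i \<in> zspan v I"
  unfolding zspan_def
  by (rule range_eqI[of _ _ "\<lambda>j. if j = i then 1 else 0"])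
     (simp add: if_distrib[of of_int] if_distrib[of "\<lambda>x. x * _"] cong: if_cong)

lemma zspan_add: "x \<in> zspan v I \<Longrightarrow> y \<in> zspan v I \<Longrightarrow> x + y \<in> zspan v I"
proof -
  assume "x \<in> zspan v I" "y \<in> zspan v I"
  then obtain c d where "x = (\<Sum>i\<in>I. of_int (c i) * v i)" "y = (\<Sum>i\<in>I. of_int (d i) * v i)"
    by (auto simp: zspan_def)
  then have "x + y = (\<Sum>i\<in>I. of_int (c i + d i) * v i)"
    by (simp add: sum.distrib ring_distribs)
  then show ?thesis by (rule zspanI)
qed

lemma zspan_int_mult: "x \<in> zspan v I \<Longrightarrow> of_int n * x \<in> zspan v I"
proof -
  assume "x \<in> zspan v I"
  then obtain c where "x = (\<Sum>i\<in>I. of_int (c i) * v i)" by (auto simp: zspan_def)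
  then have "of_int n * x = (\<Sum>i\<in>I. of_int (n * c i) * v i)"
    by (simp add: sum_distrib_left mult_ac)
  then show ?thesis by (rule zspanI)
qed

lemma zspan_sum: "(\<And>j. j \<in> J \<Longrightarrow> g j \<in> zspan v I) \<Longrightarrow> sum g J \<in> zspan v I"
proof (induction J rule: infinite_finite_induct)
  case (insert x F)
  then show ?case by (simp add: zspan_add)
next
  case empty
  show ?case by (rule zspanI[where c = "\<lambda>_. 0"]) simp
next
  case (infinite A)
  show ?case by (rule zspanI[where c = "\<lambda>_. 0"]) (simp add: infinite)
qed

lemma zspan_mult_closed:
  assumes "\<And>i. i \<in> I \<Longrightarrow> a * v i \<in> zspan v I" "x \<in> zspan v I"
  shows "a * x \<in> zspan v I"
proof -
  obtain c where c: "x = (\<Sum>i\<in>I. of_int (c i) * v i)" using assms(2) by (auto simp: zspan_def)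
  have "a * x = (\<Sum>i\<in>I. of_int (c i) * (a * v i))" by (simp add: c sum_distrib_left mult_ac)
  also have "\<dots> \<in> zspan v I" by (intro zspan_sum zspan_int_mult assms(1))
  finally show ?thesis .
qed

text \<open>The determinant trick: an integer matrix describes multiplication by \<open>x\<close> on
  the generators, and the vector of generators, nonzero by \<open>nz\<close>, is an eigenvector of
  it for the eigenvalue \<open>x\<close>. So \<open>x\<close> is a root of the characteristic
  polynomial, which is monic with integer coefficients.\<close>

lemma algebraic_int_if_zspan_invariant:
  assumes fin: "finite I" and nz: "i0 \<in> I" "v i0 \<noteq> 0"
    and inv: "\<And>i. i \<in> I \<Longrightarrow> x * v i \<in> zspan v I"
  shows "algebraic_int x"
proof -
  have "\<forall>i\<in>I. \<exists>c :: 'a \<Rightarrow> int. x * v i = (\<Sum>j\<in>I. of_int (c j) * v j)"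
    using inv by (auto simp: zspan_def)
  then obtain c :: "'a \<Rightarrow> 'a \<Rightarrow> int"
    where c: "\<And>i. i \<in> I \<Longrightarrow> x * v i = (\<Sum>j\<in>I. of_int (c i j) * v j)" by metis
  define n where "n = card I"
  obtain e where e: "bij_betw e {0..<n} I" unfolding n_def using ex_bij_betw_nat_finite[OF fin] by blast
  define M where "M = Matrix.mat n n (\<lambda>(i,j). c (e i) (e j))"
  define w where "w = Matrix.vec n (\<lambda>i. v (e i))"
  have M: "M \<in> carrier_mat n n" by (simp add: M_def)
  let ?N = "map_mat complex_of_int M"
  have N: "?N \<in> carrier_mat n n" using M by simp
  have "?N *\<^sub>v w = x \<cdot>\<^sub>v w"
  proof (rule eq_vecI)
    fix i assume "i < dim_vec (x \<cdot>\<^sub>v w)"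
    then have i: "i < n" by (simp add: w_def)
    then have "e i \<in> I" using e by (auto simp: bij_betw_def)
    have "(?N *\<^sub>v w) $ i = (\<Sum>j = 0..<n. of_int (c (e i) (e j)) * v (e j))"
      using i by (simp add: M_def w_def scalar_prod_def)
    also have "\<dots> = (\<Sum>j\<in>I. of_int (c (e i) j) * v j)"
      by (rule sum.reindex_bij_betw[OF e])
    also have "\<dots> = x * v (e i)" using c[OF \<open>e i \<in> I\<close>] by simp
    finally show "(?N *\<^sub>v w) $ i = (x \<cdot>\<^sub>v w) $ i" using i by (simp add: w_def)
  qed (simp add: w_def M_def)
  moreover have "w \<noteq> 0\<^sub>v n"
  proof
    assume w0: "w = 0\<^sub>v n"
    obtain k where k: "k < n" "e k = i0" using e nz(1) by (auto simp: bij_betw_def image_iff)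
    have "v (e k) = w $ k" using k by (simp add: w_def)
    also have "\<dots> = 0" using k w0 by simp
    finally show False using nz k by simp
  qed
  ultimately have "eigenvector ?N w x"
    using N by (simp add: eigenvector_def w_def)
  then have "poly (char_poly ?N) x = 0"
    using eigenvalue_root_char_poly[OF N] by (auto simp: eigenvalue_def)
  moreover have "char_poly ?N = map_poly of_int (char_poly M)"
    using of_int_hom.char_poly_hom[OF M] by simp
  moreover have "lead_coeff (char_poly M) = 1" using degree_monic_char_poly[OF M] by simp
  ultimately show ?thesis by (auto simp: algebraic_int_altdef_ipoly)
qed

text \<open>A monic equation expresses the top power by the lower ones. \<open>p > 0\<close> ensures
  that these include 1, the nonzero generator for the determinant trick.\<close>

lemma algebraic_int_power_zspan:
  fixes a :: complex
  assumes "algebraic_int a"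
  obtains p where "p > 0" "a ^ p \<in> zspan (\<lambda>i. a ^ i) {..<p}"
proof -
  obtain P :: "int poly" where P: "poly (map_poly of_int P) a = 0" "lead_coeff P = 1"
    using assms algebraic_int_altdef_ipoly by blast
  define p where "p = degree P"
  have "p > 0"
  proof (rule ccontr)
    assume "\<not> p > 0"
    then have "degree P = 0" by (simp add: p_def)
    then obtain c where "P = [:c:]" by (rule degree_eq_zeroE)
    then show False using P by (simp add: map_poly_pCons)
  qed
  moreover have "a ^ p \<in> zspan (\<lambda>i. a ^ i) {..<p}"
  proof -
    have "0 = (\<Sum>i\<le>p. of_int (coeff P i) * a ^ i)"
      using P(1) by (simp add: poly_altdef p_def coeff_map_poly degree_map_poly)
    also have "{..p} = insert p {..<p}" by auto
    also have "(\<Sum>i\<in>insert p {..<p}. of_int (coeff P i) * a ^ i) =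
        (\<Sum>i<p. of_int (coeff P i) * a ^ i) + a ^ p"
      using P(2) by (simp add: p_def)
    finally have "a ^ p = (\<Sum>i<p. of_int (- coeff P i) * a ^ i)"
      by (simp add: sum_negf eq_neg_iff_add_eq_0 add.commute)
    then show ?thesis by (rule zspanI)
  qed
  ultimately show ?thesis by (rule that)
qed

text \<open>Multiplication by \<open>a\<close> and by \<open>b\<close> maps the group spanned by the
  products \<open>a ^ i * b ^ j\<close> into itself, hence so does multiplication by their sum and
  their product.\<close>

lemma
  fixes a b :: complex
  assumes "algebraic_int a" "algebraic_int b"
  shows algebraic_int_add: "algebraic_int (a + b)"
    and algebraic_int_mult: "algebraic_int (a * b)"
proof -
  obtain p where p: "p > 0" "a ^ p \<in> zspan (\<lambda>i. a ^ i) {..<p}"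
    using algebraic_int_power_zspan[OF assms(1)] .
  obtain q where q: "q > 0" "b ^ q \<in> zspan (\<lambda>i. b ^ i) {..<q}"
    using algebraic_int_power_zspan[OF assms(2)] .
  define I where "I = {..<p} \<times> {..<q}"
  define v where "v = (\<lambda>(i, j). a ^ i * b ^ j)"
  have fin: "finite I" by (simp add: I_def)
  have base: "a ^ i * b ^ j \<in> zspan v I" if "i < p" "j < q" for i j
    using zspan_base[OF fin, of "(i, j)" v] that by (simp add: I_def v_def)
  have A: "a * v k \<in> zspan v I" if k: "k \<in> I" for k
  proof -
    obtain i j where ij: "k = (i, j)" "i < p" "j < q" using k by (auto simp: I_def)
    show ?thesis
    proof (cases "Suc i < p")
      case True
      then show ?thesis using base[OF True ij(3)] by (simp add: ij v_def mult.assoc)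
    next
      case False
      then have "Suc i = p" using ij by simp
      then have "a * v k = a ^ p * b ^ j" by (auto simp: ij v_def mult.assoc)
      also obtain c where "a ^ p = (\<Sum>i<p. of_int (c i) * a ^ i)"
        using p(2) by (auto simp: zspan_def)
      then have "a ^ p * b ^ j = (\<Sum>i<p. of_int (c i) * (a ^ i * b ^ j))"
        by (simp add: sum_distrib_right mult.assoc)
      also have "\<dots> \<in> zspan v I" by (intro zspan_sum zspan_int_mult base) (use ij in auto)
      finally show ?thesis .
    qed
  qed
  have B: "b * v k \<in> zspan v I" if k: "k \<in> I" for k
  proof -
    obtain i j where ij: "k = (i, j)" "i < p" "j < q" using k by (auto simp: I_def)
    show ?thesis
    proof (cases "Suc j < q")
      case True
      then show ?thesis using base[OF ij(2) True] by (simp add: ij v_def mult_ac)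
    next
      case False
      then have "Suc j = q" using ij by simp
      then have "b * v k = a ^ i * b ^ q" by (auto simp: ij v_def mult_ac)
      also obtain c where "b ^ q = (\<Sum>j<q. of_int (c j) * b ^ j)"
        using q(2) by (auto simp: zspan_def)
      then have "a ^ i * b ^ q = (\<Sum>j<q. of_int (c j) * (a ^ i * b ^ j))"
        by (simp add: sum_distrib_left mult_ac)
      also have "\<dots> \<in> zspan v I" by (intro zspan_sum zspan_int_mult base) (use ij in auto)
      finally show ?thesis .
    qed
  qed
  have one: "(0, 0) \<in> I" "v (0, 0) \<noteq> 0" using p q by (auto simp: I_def v_def)
  show "algebraic_int (a + b)"
  proof (rule algebraic_int_if_zspan_invariant[of I _ v])
    show "(a + b) * v k \<in> zspan v I" if "k \<in> I" for k
      using zspan_add[OF A[OF that] B[OF that]] by (simp add: ring_distribs)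
  qed (use fin one in auto)
  show "algebraic_int (a * b)"
  proof (rule algebraic_int_if_zspan_invariant[of I _ v])
    show "a * b * v k \<in> zspan v I" if "k \<in> I" for k
      using zspan_mult_closed[OF A B[OF that]] by (simp add: mult.assoc)
  qed (use fin one in auto)
qed

lemma algebraic_int_diff:
  fixes a b :: complex
  shows "algebraic_int a \<Longrightarrow> algebraic_int b \<Longrightarrow> algebraic_int (a - b)"
  using algebraic_int_add[of a "- b"] by simp

lemma algebraic_int_prod:
  fixes g :: "'a \<Rightarrow> complex"
  shows "(\<And>i. i \<in> I \<Longrightarrow> algebraic_int (g i)) \<Longrightarrow> algebraic_int (prod g I)"
  by (induction I rule: infinite_finite_induct) (simp_all add: algebraic_int_mult int_imp_algebraic_int)

lemma algebraic_int_coeff_prod_linear: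
  assumes "finite B" "\<And>r. r \<in> B \<Longrightarrow> algebraic_int (r :: complex)"
  shows "algebraic_int (coeff (\<Prod>r\<in>B. [:-r, 1:]) j)"
  using assms
proof (induction B arbitrary: j rule: finite_induct)
  case empty
  then show ?case by (cases j) (simp_all add: int_imp_algebraic_int coeff_1)
next
  case (insert x F)
  then show ?case
    by (auto simp: coeff_pCons algebraic_int_diff algebraic_int_mult split: nat.splits)
qed

section \<open>Denominators and general algebraic numbers\<close>

lemma algebraic_int_multiple:
  assumes "algebraic (x :: complex)"
  obtains n :: int where "n \<noteq> 0" "algebraic_int (of_int n * x)"
proof -
  obtain P :: "int poly" where P: "poly (map_poly of_int P) x = 0" "P \<noteq> 0"
    using algebraicE'[OF assms] by metis
  define d where "d = degree P"
  define n where "n = lead_coeff P"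
  have d: "d > 0"
  proof (rule ccontr)
    assume "\<not> d > 0"
    then have "degree P = 0" by (simp add: d_def)
    then obtain c where "P = [:c:]" by (rule degree_eq_zeroE)
    then show False using P by (simp add: map_poly_pCons)
  qed
  have n: "n \<noteq> 0" using P by (simp add: n_def)
  define y where "y = of_int n * x"
  \<comment> \<open>Multiplying the equation of \<open>x\<close> by \<open>n ^ (d - 1)\<close> makes
    it a monic integer equation for \<open>y = n * x\<close>: the leading term becomes
    \<open>y ^ d\<close>, and the term of degree \<open>i\<close> absorbs \<open>n ^ i\<close>,
    which leaves the integer factor \<open>n ^ (d - 1 - i)\<close>.\<close>
  have "0 = of_int n ^ (d - 1) * (\<Sum>i\<le>d. of_int (coeff P i) * x ^ i)"
    using P(1) by (simp add: poly_altdef d_def coeff_map_poly degree_map_poly)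
  also have "{..d} = insert d {..<d}" by auto
  also have "of_int n ^ (d - 1) * (\<Sum>i\<in>insert d {..<d}. of_int (coeff P i) * x ^ i) =
      of_int n ^ (d - 1) * (of_int n * x ^ d) +
      of_int n ^ (d - 1) * (\<Sum>i<d. of_int (coeff P i) * x ^ i)"
    by (simp add: n_def d_def ring_distribs)
  also have "of_int n ^ (d - 1) * (\<Sum>i<d. of_int (coeff P i) * x ^ i) =
      (\<Sum>i<d. of_int (coeff P i) * of_int n ^ (d - 1) * x ^ i)"
    unfolding sum_distrib_left by (rule sum.cong) auto
  also have "of_int n ^ (d - 1) * (of_int n * x ^ d) = of_int n ^ Suc (d - 1) * x ^ d"
    by simp
  also have "\<dots> = y ^ d"
    using d by (simp add: y_def power_mult_distrib)
  also have "(\<Sum>i<d. of_int (coeff P i) * of_int n ^ (d - 1) * x ^ i) =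
       (\<Sum>i<d. of_int (coeff P i * n ^ (d - 1 - i)) * y ^ i)"
  proof (rule sum.cong)
    fix i assume "i \<in> {..<d}"
    then have "of_int n ^ (d - 1) = (of_int n ^ (d - 1 - i) * of_int n ^ i :: complex)"
      by (simp flip: power_add)
    then show "of_int (coeff P i) * of_int n ^ (d - 1) * x ^ i = of_int (coeff P i * n ^ (d - 1 - i)) * y ^ i"
      by (simp add: y_def power_mult_distrib)
  qed simp
  finally have *: "y ^ d = (\<Sum>i<d. of_int (- (coeff P i * n ^ (d - 1 - i))) * y ^ i)"
    by (simp add: sum_negf eq_neg_iff_add_eq_0 add.commute)
  have yd: "y ^ d \<in> zspan (\<lambda>i. y ^ i) {..<d}"
    using * by (rule zspanI)
  have "algebraic_int y"
  proof (rule algebraic_int_if_zspan_invariant[of "{..<d}" 0 "\<lambda>i. y ^ i"])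
    fix i assume "i \<in> {..<d}"
    then have "y ^ Suc i \<in> zspan (\<lambda>i. y ^ i) {..<d}"
      using yd zspan_base[of "{..<d}" "Suc i" "\<lambda>i. y ^ i"]
      by (cases "Suc i = d") (auto simp del: power_Suc)
    then show "y * y ^ i \<in> zspan (\<lambda>i. y ^ i) {..<d}" by simp
  qed (use d in auto)
  then show ?thesis using that n by (simp add: y_def)
qed

lemma algebraic_if_multiple:
  assumes "n \<noteq> 0" "algebraic (of_int n * x)"
  shows "algebraic (x :: complex)"
proof -
  obtain P where P: "\<And>i. coeff P i \<in> \<int>" "P \<noteq> 0" "poly P (of_int n * x) = 0"
    using assms(2) by (auto simp: algebraic_def)
  have "coeff (P \<circ>\<^sub>p [:0, of_int n:]) i \<in> \<int>" for i
    using P(1) by (simp add: coeff_pcompose_linear Ints_mult Ints_power)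
  moreover have "P \<circ>\<^sub>p [:0, of_int n:] \<noteq> 0" using P(2) assms(1) by (subst pcompose_eq_0_iff) auto
  moreover have "poly (P \<circ>\<^sub>p [:0, of_int n:]) x = 0" using P(3) by (simp add: poly_pcompose mult.commute)
  ultimately show ?thesis by (rule algebraicI)
qed

text \<open>Clearing denominators reduces both claims to algebraic integers; the common denominator
  \<open>m * n\<close> is removed afterwards.\<close>

lemma
  fixes a b :: complex
  assumes "algebraic a" "algebraic b"
  shows algebraic_add: "algebraic (a + b)"
    and algebraic_mult: "algebraic (a * b)"
proof -
  obtain m n :: int where m: "m \<noteq> 0" "algebraic_int (of_int m * a)"
    and n: "n \<noteq> 0" "algebraic_int (of_int n * b)"
    using assms algebraic_int_multiple by metis
  have ai: "algebraic_int (of_int k * z)" if "algebraic_int z" for k and z :: complex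
    using that by (simp add: algebraic_int_mult int_imp_algebraic_int)
  have "algebraic_int (of_int n * (of_int m * a) + of_int m * (of_int n * b))"
    by (intro algebraic_int_add ai m n)
  also have "of_int n * (of_int m * a) + of_int m * (of_int n * b) = of_int (m * n) * (a + b)"
    by (simp add: algebra_simps)
  finally show "algebraic (a + b)" using algebraic_if_multiple[of "m * n"] m n by auto
  have "algebraic_int ((of_int m * a) * (of_int n * b))"
    by (intro algebraic_int_mult m n)
  also have "(of_int m * a) * (of_int n * b) = of_int (m * n) * (a * b)"
    by (simp add: algebra_simps)
  finally show "algebraic (a * b)" using algebraic_if_multiple[of "m * n"] m n by auto
qed

section \<open>Embeddings of number fields\<close>

definition csubfield :: "complex set \<Rightarrow> bool" where
  "csubfield F \<longleftrightarrow> 1 \<in> F \<and> (\<forall>x\<in>F. \<forall>y\<in>F. x + y \<in> F \<and> x * y \<in> F) \<and> (\<forall>x\<in>F. - x \<in> F \<and> inverse x \<in> F)"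

text \<open>Only the values on \<open>F\<close> are constrained, so that \<open>cnj\<close> and the
  extensional Galois automorphisms both qualify. Injectivity follows because \<open>F\<close> is a
  field.\<close>

definition embedding :: "complex set \<Rightarrow> (complex \<Rightarrow> complex) \<Rightarrow> bool" where
  "embedding F \<sigma> \<longleftrightarrow> \<sigma> 1 = 1 \<and> (\<forall>x\<in>F. \<forall>y\<in>F. \<sigma> (x + y) = \<sigma> x + \<sigma> y \<and> \<sigma> (x * y) = \<sigma> x * \<sigma> y)"

text \<open>\<open>F\<close> may be any set: besides subfields, \<open>\<int>\<close> is
  used.\<close>

definition polys_over :: "complex set \<Rightarrow> complex poly set" where
  "polys_over F = {p. \<forall>i. coeff p i \<in> F}"

lemma csubfieldD:
  assumes "csubfield F"
  shows "1 \<in> F" "0 \<in> F" "x \<in> F \<Longrightarrow> y \<in> F \<Longrightarrow> x + y \<in> F" "x \<in> F \<Longrightarrow> y \<in> F \<Longrightarrow> x * y \<in> F"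
    "x \<in> F \<Longrightarrow> - x \<in> F" "x \<in> F \<Longrightarrow> inverse x \<in> F" "x \<in> F \<Longrightarrow> y \<in> F \<Longrightarrow> x - y \<in> F"
    "x \<in> F \<Longrightarrow> y \<in> F \<Longrightarrow> x / y \<in> F"
proof -
  show 1: "1 \<in> F" and add: "x \<in> F \<Longrightarrow> y \<in> F \<Longrightarrow> x + y \<in> F"
    and mult: "x \<in> F \<Longrightarrow> y \<in> F \<Longrightarrow> x * y \<in> F"
    and um: "x \<in> F \<Longrightarrow> - x \<in> F" and inv: "x \<in> F \<Longrightarrow> inverse x \<in> F" for x y
    using assms by (auto simp: csubfield_def)
  show "0 \<in> F" using add[OF 1 um[OF 1]] by simp
  show "x \<in> F \<Longrightarrow> y \<in> F \<Longrightarrow> x - y \<in> F" using add[OF _ um, of x y] by simp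
  show "x \<in> F \<Longrightarrow> y \<in> F \<Longrightarrow> x / y \<in> F" using mult[OF _ inv, of x y] by (simp add: divide_inverse)
qed

lemma csubfield_sum:
  assumes "csubfield F" "\<And>i. i \<in> I \<Longrightarrow> g i \<in> F"
  shows "sum g I \<in> F"
  using assms(2) by (induction I rule: infinite_finite_induct) (simp_all add: csubfieldD[OF assms(1)])

lemma csubfield_prod:
  assumes "csubfield F" "\<And>i. i \<in> I \<Longrightarrow> g i \<in> F"
  shows "prod g I \<in> F"
  using assms(2) by (induction I rule: infinite_finite_induct) (simp_all add: csubfieldD[OF assms(1)])

lemma csubfield_Rats: "csubfield \<rat>"
  by (auto simp: csubfield_def)

lemma csubfield_algebraic: "csubfield {z. algebraic z}"
  by (auto simp: csubfield_def algebraic_add algebraic_mult rat_imp_algebraic)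

lemma Rats_subset_csubfield:
  assumes "csubfield F"
  shows "\<rat> \<subseteq> F"
proof
  note [simp] = csubfieldD[OF assms]
  have nat: "of_nat n \<in> F" for n by (induction n) simp_all
  have int: "of_int k \<in> F" for k by (cases k rule: int_cases2) (simp_all add: nat)
  fix x :: complex assume "x \<in> \<rat>"
  then obtain a b :: int where "x = of_int a / of_int b" by (rule Rats_cases')
  then show "x \<in> F" by (simp add: int)
qed

section \<open>Elementary properties of embeddings\<close>

context
  fixes F \<sigma>
  assumes F: "csubfield F" and \<sigma>: "embedding F \<sigma>"
begin

lemma embedding_add: "x \<in> F \<Longrightarrow> y \<in> F \<Longrightarrow> \<sigma> (x + y) = \<sigma> x + \<sigma> y"
  and embedding_mult: "x \<in> F \<Longrightarrow> y \<in> F \<Longrightarrow> \<sigma> (x * y) = \<sigma> x * \<sigma> y"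
  and embedding_1: "\<sigma> 1 = 1"
  using \<sigma> by (auto simp: embedding_def)

lemma embedding_0: "\<sigma> 0 = 0"
  using embedding_add[OF csubfieldD(2)[OF F] csubfieldD(2)[OF F]] add_cancel_right_right by fastforce

lemma embedding_uminus: "x \<in> F \<Longrightarrow> \<sigma> (- x) = - \<sigma> x"
  using embedding_add[OF _ csubfieldD(5)[OF F], of x x] embedding_0
  by (simp add: eq_neg_iff_add_eq_0 add.commute)

lemma embedding_diff: "x \<in> F \<Longrightarrow> y \<in> F \<Longrightarrow> \<sigma> (x - y) = \<sigma> x - \<sigma> y"
  using embedding_add[OF _ csubfieldD(5)[OF F], of x y] embedding_uminus by simp

lemma embedding_inverse: "x \<in> F \<Longrightarrow> \<sigma> (inverse x) = inverse (\<sigma> x)"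
proof (cases "x = 0")
  case False
  assume "x \<in> F"
  then have "\<sigma> x * \<sigma> (inverse x) = 1"
    using embedding_mult[OF _ csubfieldD(6)[OF F], of x x] embedding_1 False by simp
  then show ?thesis by (metis inverse_unique)
qed (simp add: embedding_0)

lemma embedding_eq_0: "x \<in> F \<Longrightarrow> \<sigma> x = 0 \<longleftrightarrow> x = 0"
  using embedding_mult[OF _ csubfieldD(6)[OF F], of x x] embedding_1 embedding_0 by (cases "x = 0") auto

lemma embedding_inj: "inj_on \<sigma> F"
proof (rule inj_onI)
  fix x y assume "x \<in> F" "y \<in> F" "\<sigma> x = \<sigma> y"
  then show "x = y"
    using embedding_diff[of x y] embedding_eq_0[OF csubfieldD(7)[OF F], of x y] by simp
qed

lemma embedding_Rats: "q \<in> \<rat> \<Longrightarrow> \<sigma> q = q"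
proof -
  note [simp] = csubfieldD[OF F] embedding_add embedding_mult embedding_0 embedding_1
    embedding_uminus embedding_inverse
  have F_nat: "of_nat n \<in> F" for n by (induction n) simp_all
  have nat: "\<sigma> (of_nat n) = of_nat n" for n by (induction n) (simp_all add: F_nat)
  have F_int: "of_int k \<in> F" for k by (cases k rule: int_cases2) (simp_all add: F_nat)
  have int: "\<sigma> (of_int k) = of_int k" for k
    by (cases k rule: int_cases2) (simp_all add: F_nat nat)
  assume "q \<in> \<rat>"
  then obtain a b :: int where "q = of_int a / of_int b" by (rule Rats_cases')
  then show "\<sigma> q = q" by (simp add: int F_int divide_inverse)
qed

lemma embedding_sum: "(\<And>i. i \<in> I \<Longrightarrow> g i \<in> F) \<Longrightarrow> \<sigma> (sum g I) = (\<Sum>i\<in>I. \<sigma> (g i))"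
  by (induction I rule: infinite_finite_induct)
     (simp_all add: embedding_0 embedding_add csubfield_sum[OF F])

lemma embedding_prod: "(\<And>i. i \<in> I \<Longrightarrow> g i \<in> F) \<Longrightarrow> \<sigma> (prod g I) = (\<Prod>i\<in>I. \<sigma> (g i))"
  by (induction I rule: infinite_finite_induct)
     (simp_all add: embedding_1 embedding_mult csubfield_prod[OF F])

lemma embedding_power: "x \<in> F \<Longrightarrow> \<sigma> (x ^ n) = \<sigma> x ^ n"
  using embedding_prod[of "{..<n}" "\<lambda>_. x"] by simp

lemma coeff_map_embedding: "coeff (map_poly \<sigma> p) i = \<sigma> (coeff p i)"
  by (simp add: coeff_map_poly embedding_0)

lemma map_embedding_add:
  "p \<in> polys_over F \<Longrightarrow> q \<in> polys_over F \<Longrightarrow> map_poly \<sigma> (p + q) = map_poly \<sigma> p + map_poly \<sigma> q"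
  by (rule poly_eqI) (simp add: coeff_map_embedding embedding_add polys_over_def)

lemma map_embedding_mult:
  "p \<in> polys_over F \<Longrightarrow> q \<in> polys_over F \<Longrightarrow> map_poly \<sigma> (p * q) = map_poly \<sigma> p * map_poly \<sigma> q"
  by (rule poly_eqI)
     (simp add: coeff_map_embedding coeff_mult embedding_sum embedding_mult polys_over_def csubfieldD[OF F])

lemma degree_map_embedding: "p \<in> polys_over F \<Longrightarrow> degree (map_poly \<sigma> p) = degree p"
proof (cases "p = 0")
  case False
  assume "p \<in> polys_over F"
  then have "\<sigma> (lead_coeff p) \<noteq> 0" using False embedding_eq_0[of "lead_coeff p"] by (simp add: polys_over_def)
  then show ?thesis by (rule map_poly_degree_eq)
qed simp

lemma poly_map_embedding:
  assumes "p \<in> polys_over F" "x \<in> F"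
  shows "\<sigma> (poly p x) = poly (map_poly \<sigma> p) (\<sigma> x)"
proof -
  have pw: "x ^ n \<in> F" for n using csubfieldD[OF F] assms(2) by (induction n) auto
  show ?thesis
    using assms pw
    by (simp add: poly_altdef degree_map_embedding coeff_map_embedding embedding_sum embedding_mult
        embedding_power polys_over_def csubfieldD[OF F])
qed

end

section \<open>Division, minimal polynomials and simple extensions over a subfield\<close>

context
  fixes F
  assumes F: "csubfield F"
begin

lemma polys_over_add: "p \<in> polys_over F \<Longrightarrow> q \<in> polys_over F \<Longrightarrow> p + q \<in> polys_over F"
  and polys_over_diff: "p \<in> polys_over F \<Longrightarrow> q \<in> polys_over F \<Longrightarrow> p - q \<in> polys_over F"
  and polys_over_mult: "p \<in> polys_over F \<Longrightarrow> q \<in> polys_over F \<Longrightarrow> p * q \<in> polys_over F"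
  and polys_over_pCons: "c \<in> F \<Longrightarrow> p \<in> polys_over F \<Longrightarrow> pCons c p \<in> polys_over F"
  and polys_over_0: "0 \<in> polys_over F"
  and polys_over_1: "1 \<in> polys_over F"
  by (auto simp: polys_over_def csubfieldD[OF F] coeff_mult coeff_pCons coeff_1
      intro!: csubfield_sum[OF F] split: nat.splits)

lemma polys_over_prod: "(\<And>i. i \<in> I \<Longrightarrow> g i \<in> polys_over F) \<Longrightarrow> prod g I \<in> polys_over F"
  by (induction I rule: infinite_finite_induct) (simp_all add: polys_over_1 polys_over_mult)

lemma polys_over_poly: "p \<in> polys_over F \<Longrightarrow> x \<in> F \<Longrightarrow> poly p x \<in> F"
proof (induction p)
  case (pCons a p)
  have "coeff (pCons a p) 0 \<in> F" "\<And>i. coeff (pCons a p) (Suc i) \<in> F"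
    using pCons.prems by (auto simp: polys_over_def simp del: coeff_pCons_Suc coeff_pCons_0)
  then have "a \<in> F" "p \<in> polys_over F" by (auto simp: polys_over_def)
  then show ?case using pCons by (simp add: csubfieldD[OF F])
qed (simp add: csubfieldD[OF F])

text \<open>Long division divides only by the leading coefficient of \<open>m\<close>, so quotient
  and remainder stay over \<open>F\<close>. The alternative \<open>r = 0\<close> covers constant
  \<open>m\<close>, as the zero polynomial has degree 0.\<close>

lemma polys_over_division:
  assumes "m \<in> polys_over F" "m \<noteq> 0" "p \<in> polys_over F"
  shows "\<exists>q\<in>polys_over F. \<exists>r\<in>polys_over F. p = m * q + r \<and> (r = 0 \<or> degree r < degree m)"
  using assms(3)
proof (induction "degree p" arbitrary: p rule: less_induct)
  case less
  show ?case
  proof (cases "p = 0 \<or> degree p < degree m")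
    case True
    then show ?thesis using less.prems polys_over_0 by (intro bexI[of _ 0] bexI[of _ p]) auto
  next
    case False
    define t where "t = monom (lead_coeff p / lead_coeff m) (degree p - degree m)"
    have t: "t \<in> polys_over F"
      unfolding t_def using less.prems assms by (auto simp: polys_over_def csubfieldD[OF F])
    define p' where "p' = p - t * m"
    have p': "p' \<in> polys_over F" unfolding p'_def by (intro polys_over_diff polys_over_mult less.prems t assms)
    have c0: "lead_coeff p / lead_coeff m \<noteq> 0" using False assms(2) by simp
    then have dt: "degree t = degree p - degree m" unfolding t_def by (rule degree_monom_eq)
    moreover have "t \<noteq> 0" using c0 by (simp add: t_def)
    ultimately have dtm: "degree (t * m) = degree p" using False assms(2) by (simp add: degree_mult_eq)
    have "lead_coeff (t * m) = lead_coeff t * lead_coeff m" by (rule lead_coeff_mult)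
    also have "lead_coeff t = lead_coeff p / lead_coeff m" unfolding dt by (simp add: t_def)
    finally have tm: "degree (t * m) = degree p" "lead_coeff (t * m) = lead_coeff p"
      using dtm assms(2) by auto
    have "p' = 0 \<or> degree p' < degree p"
    proof (cases "degree p = 0")
      \<comment> \<open>In degree 0 the degree cannot drop; cancelling the leading coefficient makes
        \<open>p'\<close> zero instead.\<close>
      case True
      then have "degree p' = 0" using tm unfolding p'_def by (metis degree_diff_le le_zero_eq max.idem order_refl)
      moreover have "coeff p' 0 = 0" using tm True by (simp add: p'_def)
      ultimately have "p' = 0" by (metis leading_coeff_0_iff)
      then show ?thesis ..
    next
      case False
      have "degree p' \<le> degree p" unfolding p'_def using tm by (intro degree_diff_le) auto
      moreover have "coeff p' (degree p) = 0" using tm by (simp add: p'_def)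
      ultimately show ?thesis using False
        by (metis le_neq_implies_less leading_coeff_0_iff)
    qed
    then have "\<exists>q\<in>polys_over F. \<exists>r\<in>polys_over F. p' = m * q + r \<and> (r = 0 \<or> degree r < degree m)"
    proof
      assume "p' = 0"
      then show ?thesis using polys_over_0 by (intro bexI[of _ 0]) auto
    qed (use less.hyps p' in blast)
    then obtain q r where qr: "q \<in> polys_over F" "r \<in> polys_over F" "p' = m * q + r"
      "r = 0 \<or> degree r < degree m" by blast
    have "p = m * (q + t) + r" using qr(3) by (simp add: p'_def algebra_simps)
    then show ?thesis using qr polys_over_add[OF qr(1) t] by blast
  qed
qed

text \<open>Least degree rather than irreducibility is the convenient form of minimality here.\<close>
definition min_poly_over :: "complex \<Rightarrow> complex poly \<Rightarrow> bool" where
  "min_poly_over a m \<longleftrightarrow> m \<in> polys_over F \<and> m \<noteq> 0 \<and> poly m a = 0 \<and>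
     (\<forall>q\<in>polys_over F. q \<noteq> 0 \<longrightarrow> poly q a = 0 \<longrightarrow> degree m \<le> degree q)"

lemma min_poly_over_exists:
  assumes "algebraic a"
  shows "\<exists>m. min_poly_over a m"
proof -
  obtain P where P: "\<And>i. coeff P i \<in> \<int>" "P \<noteq> 0" "poly P a = 0"
    using assms by (auto simp: algebraic_def)
  have "coeff P i \<in> F" for i
    using P(1)[of i] Rats_subset_csubfield[OF F] Ints_subset_Rats by blast
  then have "P \<in> polys_over F \<and> P \<noteq> 0 \<and> poly P a = 0" using P by (simp add: polys_over_def)
  then obtain m where "m \<in> polys_over F \<and> m \<noteq> 0 \<and> poly m a = 0"
    and "\<And>q. q \<in> polys_over F \<and> q \<noteq> 0 \<and> poly q a = 0 \<Longrightarrow> degree m \<le> degree q"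
    using ex_has_least_nat[of "\<lambda>p. p \<in> polys_over F \<and> p \<noteq> 0 \<and> poly p a = 0" P degree] by blast
  then show ?thesis unfolding min_poly_over_def by blast
qed

text \<open>The remainder of \<open>q\<close> vanishes at \<open>a\<close> too, so minimality of the
  degree of \<open>m\<close> makes it zero.\<close>

lemma min_poly_over_dvd:
  assumes m: "min_poly_over a m" and q: "q \<in> polys_over F" "poly q a = 0"
  obtains k where "k \<in> polys_over F" "q = m * k"
proof -
  obtain k r where kr: "k \<in> polys_over F" "r \<in> polys_over F" "q = m * k + r" "r = 0 \<or> degree r < degree m"
    using polys_over_division[of m q] m q(1) by (auto simp: min_poly_over_def)
  have "poly r a = 0" using kr(3) q(2) m by (simp add: min_poly_over_def)
  then have "r = 0" using kr m by (force simp: min_poly_over_def)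
  then show ?thesis using kr that by simp
qed

lemma degree_min_poly_over: "min_poly_over a m \<Longrightarrow> degree m > 0"
  by (rule ccontr) (auto simp: min_poly_over_def elim!: degree_eq_zeroE)

text \<open>In the ideal generated by \<open>m\<close> and \<open>q\<close> over \<open>F\<close>,
  an element \<open>g\<close> of least degree divides both. As it divides \<open>q\<close>, it does
  not vanish at \<open>a\<close>, so its cofactor in \<open>m\<close> does; minimality of
  \<open>m\<close> then makes \<open>g\<close> constant, and \<open>g = u * m + v * q\<close>
  evaluated at \<open>a\<close> yields the inverse.\<close>

lemma simple_extension_inverse:
  assumes m: "min_poly_over a m" and q: "q \<in> polys_over F" "poly q a \<noteq> 0"
  shows "\<exists>v\<in>polys_over F. inverse (poly q a) = poly v a"
proof -
  have mF: "m \<in> polys_over F" "m \<noteq> 0" "poly m a = 0" using m by (auto simp: min_poly_over_def)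
  define I where "I = {u * m + v * q |u v. u \<in> polys_over F \<and> v \<in> polys_over F}"
  have I_sub: "I \<subseteq> polys_over F" unfolding I_def using mF q by (auto intro!: polys_over_add polys_over_mult)
  have "m \<in> I" unfolding I_def using polys_over_1 polys_over_0
    by (intro CollectI exI[of _ 1] exI[of _ 0]) simp
  have "q \<in> I" unfolding I_def using polys_over_1 polys_over_0
    by (intro CollectI exI[of _ 0] exI[of _ 1]) simp
  obtain g where g: "g \<in> I" "g \<noteq> 0" and least: "\<And>h. h \<in> I \<Longrightarrow> h \<noteq> 0 \<Longrightarrow> degree g \<le> degree h"
    using ex_has_least_nat[of "\<lambda>p. p \<in> I \<and> p \<noteq> 0" m degree] \<open>m \<in> I\<close> mF(2) by blast
  have dvd: "\<exists>k\<in>polys_over F. h = g * k" if h: "h \<in> I" for h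
  proof -
    obtain k r where kr: "k \<in> polys_over F" "r \<in> polys_over F" "h = g * k + r" "r = 0 \<or> degree r < degree g"
      using polys_over_division[of g h] g I_sub h by blast
    obtain u1 v1 u2 v2 where uv: "h = u1 * m + v1 * q" "g = u2 * m + v2 * q"
      "u1 \<in> polys_over F" "v1 \<in> polys_over F" "u2 \<in> polys_over F" "v2 \<in> polys_over F"
      using h g(1) unfolding I_def by blast
    have "r = (u1 - u2 * k) * m + (v1 - v2 * k) * q" using kr(3) uv by (simp add: algebra_simps)
    then have "r \<in> I" unfolding I_def using uv kr(1)
      by (intro CollectI exI[of _ "u1 - u2 * k"] exI[of _ "v1 - v2 * k"])
         (auto intro!: polys_over_diff polys_over_mult)
    then have "r = 0" using least kr(4) by (meson not_less)
    then show ?thesis using kr by auto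
  qed
  obtain l where l: "q = g * l" using dvd[OF \<open>q \<in> I\<close>] by blast
  obtain k where k: "k \<in> polys_over F" "m = g * k" using dvd[OF \<open>m \<in> I\<close>] by blast
  have ga: "poly g a \<noteq> 0" using q(2) l by auto
  then have "poly k a = 0" using mF(3) k(2) by simp
  moreover have "k \<noteq> 0" using k mF(2) by auto
  ultimately have "degree m \<le> degree k" using m k(1) by (auto simp: min_poly_over_def)
  then have "degree g = 0" using k(2) mF(2) g(2) \<open>k \<noteq> 0\<close> by (simp add: degree_mult_eq)
  then obtain c where c: "g = [:c:]" by (rule degree_eq_zeroE)
  have c0: "c \<noteq> 0" "c \<in> F"
    using g I_sub c by (auto simp: polys_over_def dest!: subsetD spec[of _ 0])
  obtain u v where uv: "g = u * m + v * q" "v \<in> polys_over F" using g(1) unfolding I_def by blast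
  have "c = poly g a" by (simp add: c)
  also have "\<dots> = poly v a * poly q a" using uv mF(3) by simp
  finally have "inverse (poly q a) = poly ([:inverse c:] * v) a" using c0 q(2) by (simp add: field_simps)
  moreover have "[:inverse c:] * v \<in> polys_over F"
    using c0 uv(2) csubfieldD(6)[OF F] by (intro polys_over_mult polys_over_pCons polys_over_0)
  ultimately show ?thesis by blast
qed

text \<open>The extension consists of the values at \<open>a\<close> of polynomials over
  \<open>F\<close>, and \<open>\<tau>\<close> sends the value of \<open>q\<close> at
  \<open>a\<close> to the value at \<open>b\<close> of the image of \<open>q\<close> under
  \<open>\<sigma>\<close>. The minimality of \<open>F'\<close> is recorded so that a chain of
  extensions can be identified with a given field.\<close>

lemma embedding_extend_simple:
  assumes \<sigma>: "embedding F \<sigma>" and m: "min_poly_over a m" and b: "poly (map_poly \<sigma> m) b = 0"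
  shows "\<exists>F' \<tau>. csubfield F' \<and> embedding F' \<tau> \<and> insert a F \<subseteq> F' \<and> (\<forall>x\<in>F. \<tau> x = \<sigma> x) \<and> \<tau> a = b \<and>
           (\<forall>E. csubfield E \<longrightarrow> insert a F \<subseteq> E \<longrightarrow> F' \<subseteq> E)"
proof -
  define F' where "F' = (\<lambda>q. poly q a) ` polys_over F"
  define \<tau> where "\<tau> x = poly (map_poly \<sigma> (SOME q. q \<in> polys_over F \<and> poly q a = x)) b" for x
  have mF: "m \<in> polys_over F" using m by (simp add: min_poly_over_def)
  \<comment> \<open>Independence of the representative: two of them differ by a multiple of
    \<open>m\<close>, whose image under \<open>\<sigma>\<close> vanishes at
    \<open>b\<close>.\<close>
  have \<tau>: "\<tau> (poly q a) = poly (map_poly \<sigma> q) b" if q: "q \<in> polys_over F" for q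
  proof -
    define q' where "q' = (SOME q'. q' \<in> polys_over F \<and> poly q' a = poly q a)"
    have q': "q' \<in> polys_over F" "poly q' a = poly q a"
      using someI[of "\<lambda>q'. q' \<in> polys_over F \<and> poly q' a = poly q a" q] q unfolding q'_def by auto
    obtain k where k: "k \<in> polys_over F" "q' - q = m * k"
      using min_poly_over_dvd[OF m, of "q' - q"] polys_over_diff[OF q'(1) q] q'(2) by auto
    have "map_poly \<sigma> q' = map_poly \<sigma> (q + m * k)" using k(2) by (metis add_diff_cancel_left' add_diff_eq)
    also have "\<dots> = map_poly \<sigma> q + map_poly \<sigma> m * map_poly \<sigma> k"
      using q k mF by (simp add: map_embedding_add[OF F \<sigma>] map_embedding_mult[OF F \<sigma>] polys_over_mult)
    finally show ?thesis using b unfolding \<tau>_def q'_def[symmetric] by simp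
  qed
  have "csubfield F'"
    unfolding csubfield_def
  proof (intro conjI ballI)
    show "1 \<in> F'" unfolding F'_def by (rule image_eqI[OF _ polys_over_1]) simp
    fix x assume "x \<in> F'"
    then obtain p where p: "p \<in> polys_over F" "x = poly p a" unfolding F'_def by blast
    show "- x \<in> F'" unfolding F'_def
      by (rule image_eqI[OF _ polys_over_diff[OF polys_over_0 p(1)]]) (simp add: p)
    show "inverse x \<in> F'"
    proof (cases "x = 0")
      case True
      then show ?thesis unfolding F'_def by (intro image_eqI[OF _ polys_over_0]) simp
    next
      case False
      then show ?thesis unfolding F'_def using simple_extension_inverse[OF m p(1)] p(2) by auto
    qed
    fix y assume "y \<in> F'"
    then obtain q where q: "q \<in> polys_over F" "y = poly q a" unfolding F'_def by blast
    show "x + y \<in> F'" unfolding F'_def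
      by (rule image_eqI[OF _ polys_over_add[OF p(1) q(1)]]) (simp add: p q)
    show "x * y \<in> F'" unfolding F'_def
      by (rule image_eqI[OF _ polys_over_mult[OF p(1) q(1)]]) (simp add: p q)
  qed
  moreover have "embedding F' \<tau>"
    unfolding embedding_def
  proof (intro conjI ballI)
    have one: "map_poly \<sigma> 1 = 1" by (rule map_poly_1') (rule embedding_1[OF F \<sigma>])
    show "\<tau> 1 = 1" using \<tau>[OF polys_over_1] one by simp
    fix x y assume "x \<in> F'" "y \<in> F'"
    then obtain p q where p: "p \<in> polys_over F" "x = poly p a" and q: "q \<in> polys_over F" "y = poly q a"
      unfolding F'_def by blast
    show "\<tau> (x + y) = \<tau> x + \<tau> y"
      using \<tau>[OF polys_over_add[OF p(1) q(1)]] \<tau>[OF p(1)] \<tau>[OF q(1)] p q map_embedding_add[OF F \<sigma> p(1) q(1)]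
      by simp
    show "\<tau> (x * y) = \<tau> x * \<tau> y"
      using \<tau>[OF polys_over_mult[OF p(1) q(1)]] \<tau>[OF p(1)] \<tau>[OF q(1)] p q map_embedding_mult[OF F \<sigma> p(1) q(1)]
      by simp
  qed
  moreover have const: "x \<in> F' \<and> \<tau> x = \<sigma> x" if "x \<in> F" for x
  proof -
    have x: "[:x:] \<in> polys_over F" using that by (simp add: polys_over_pCons polys_over_0)
    have "map_poly \<sigma> [:x:] = [:\<sigma> x:]"
      by (rule poly_eqI) (simp add: coeff_map_embedding[OF F \<sigma>] coeff_pCons embedding_0[OF F \<sigma>] split: nat.splits)
    then show ?thesis using \<tau>[OF x] image_eqI[OF _ x, of x "\<lambda>q. poly q a"]
      by (simp add: F'_def)
  qed
  moreover have "a \<in> F' \<and> \<tau> a = b"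
  proof -
    have x: "[:0, 1:] \<in> polys_over F" by (intro polys_over_pCons polys_over_0 csubfieldD(1,2)[OF F])
    have "map_poly \<sigma> [:0, 1:] = [:0, 1:]"
      by (rule poly_eqI) (simp add: coeff_map_embedding[OF F \<sigma>] coeff_pCons embedding_0[OF F \<sigma>]
          embedding_1[OF F \<sigma>] split: nat.splits)
    then show ?thesis using \<tau>[OF x] image_eqI[OF _ x, of a "\<lambda>q. poly q a"]
      by (simp add: F'_def)
  qed
  moreover have "F' \<subseteq> E" if E: "csubfield E" "insert a F \<subseteq> E" for E
  proof
    fix x assume "x \<in> F'"
    then obtain p where p: "p \<in> polys_over F" "x = poly p a" unfolding F'_def by blast
    have pw: "a ^ n \<in> E" for n using csubfieldD[OF E(1)] E(2) by (induction n) auto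
    have "poly p a = (\<Sum>i\<le>degree p. coeff p i * a ^ i)" by (rule poly_altdef)
    also have "\<dots> \<in> E" using p(1) E(2) pw
      by (intro csubfield_sum[OF E(1)] csubfieldD(4)[OF E(1)]) (auto simp: polys_over_def)
    finally show "x \<in> E" using p by simp
  qed
  ultimately show ?thesis by (intro exI[of _ F'] exI[of _ \<tau>]) blast
qed

end

text \<open>The elements are adjoined one at a time. A possible image is a root of the transported
  minimal polynomial, which exists because the complex numbers are algebraically closed.\<close>

lemma embedding_extend_finite:
  assumes "finite S" "\<And>a. a \<in> S \<Longrightarrow> algebraic a" "csubfield F" "embedding F \<sigma>"
  shows "\<exists>F' \<tau>. csubfield F' \<and> embedding F' \<tau> \<and> F \<union> S \<subseteq> F' \<and> (\<forall>x\<in>F. \<tau> x = \<sigma> x) \<and>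
           (\<forall>E. csubfield E \<longrightarrow> F \<union> S \<subseteq> E \<longrightarrow> F' \<subseteq> E)"
  using assms
proof (induction S arbitrary: F \<sigma> rule: finite_induct)
  case empty
  then show ?case by (intro exI[of _ F] exI[of _ \<sigma>]) auto
next
  case (insert a S)
  obtain m where m: "min_poly_over F a m"
    using min_poly_over_exists[OF insert.prems(2), of a] insert.prems(1) by blast
  have mF: "m \<in> polys_over F" using m insert.prems by (simp add: min_poly_over_def)
  have "degree (map_poly \<sigma> m) > 0"
    using degree_min_poly_over[OF insert.prems(2) m] degree_map_embedding[OF insert.prems(2,3) mF] by simp
  then have "\<not> constant (poly (map_poly \<sigma> m))" by (simp add: constant_degree)
  then obtain b where "poly (map_poly \<sigma> m) b = 0" using fundamental_theorem_of_algebra by blast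
  from embedding_extend_simple[OF insert.prems(2,3) m this]
  obtain F1 \<sigma>1 where F1: "csubfield F1" "embedding F1 \<sigma>1" "insert a F \<subseteq> F1" "\<forall>x\<in>F. \<sigma>1 x = \<sigma> x"
    "\<forall>E. csubfield E \<longrightarrow> insert a F \<subseteq> E \<longrightarrow> F1 \<subseteq> E" by blast
  from insert.IH[OF _ F1(1,2)] insert.prems(1)
  obtain F2 \<tau> where F2: "csubfield F2" "embedding F2 \<tau>" "F1 \<union> S \<subseteq> F2" "\<forall>x\<in>F1. \<tau> x = \<sigma>1 x"
    "\<forall>E. csubfield E \<longrightarrow> F1 \<union> S \<subseteq> E \<longrightarrow> F2 \<subseteq> E" by blast
  show ?case
  proof (intro exI[of _ F2] exI[of _ \<tau>] conjI allI impI)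
    fix E assume "csubfield E" "F \<union> insert a S \<subseteq> E"
    then show "F2 \<subseteq> E" using F1(5) F2(5) by simp
  qed (use F1 F2 in auto)
qed

text \<open>The minimal polynomial of an irrational \<open>x\<close> has a second root; sending
  \<open>x\<close> there and extending over the generators \<open>S\<close> gives an embedding of
  all of \<open>K\<close>. This is the part of the Galois correspondence by which numbers are later
  recognized as rational.\<close>

lemma embedding_moving_irrational:
  assumes S: "finite S" "\<And>a. a \<in> S \<Longrightarrow> algebraic a"
    and K: "csubfield K" "S \<subseteq> K" "\<And>E. csubfield E \<Longrightarrow> S \<subseteq> E \<Longrightarrow> K \<subseteq> E"
    and x: "x \<in> K" "x \<notin> \<rat>"
  shows "\<exists>\<tau>. embedding K \<tau> \<and> \<tau> x \<noteq> x"
proof -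
  have "algebraic x" using K(3)[OF csubfield_algebraic] S(2) x(1) by blast
  then obtain m where m: "min_poly_over \<rat> x m" using min_poly_over_exists[OF csubfield_Rats] by blast
  have mF: "m \<in> polys_over \<rat>" "m \<noteq> 0" "poly m x = 0"
    and least: "\<And>q. q \<in> polys_over \<rat> \<Longrightarrow> q \<noteq> 0 \<Longrightarrow> poly q x = 0 \<Longrightarrow> degree m \<le> degree q"
    using m by (auto simp: min_poly_over_def[OF csubfield_Rats])
  have d0: "degree m > 0" using degree_min_poly_over[OF csubfield_Rats m] .
  have "degree m \<noteq> 1"
  proof
    assume "degree m = 1"
    then have "coeff m 0 + coeff m 1 * x = 0" "coeff m 1 \<noteq> 0"
      using mF(2,3) by (auto simp: poly_altdef leading_coeff_0_iff)
    then have "x = - coeff m 0 / coeff m 1" by (simp add: field_simps eq_neg_iff_add_eq_0 add.commute)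
    moreover have "- coeff m 0 / coeff m 1 \<in> \<rat>" using mF(1) by (auto simp: polys_over_def)
    ultimately show False using x(2) by simp
  qed
  have "\<exists>b. poly m b = 0 \<and> b \<noteq> x"
  proof (rule ccontr)
    \<comment> \<open>With no other root, \<open>m\<close> is a constant times a power of the linear
      factor of \<open>x\<close>, of exponent at least 2. Its derivative then also vanishes at
      \<open>x\<close>, against minimality.\<close>
    assume no: "\<not> ?thesis"
    obtain as where as: "smult (lead_coeff m) (\<Prod>a\<leftarrow>as. [:- a, 1:]) = m" "length as = degree m"
      using fundamental_theorem_algebra_factorized[of m] by blast
    have "a = x" if "a \<in> set as" for a
    proof -
      have "poly (\<Prod>a\<leftarrow>as. [:- a, 1:]) a = 0" using that by (induction as) auto
      then have "poly (smult (lead_coeff m) (\<Prod>a\<leftarrow>as. [:- a, 1:])) a = 0" by simp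
      then show ?thesis using no unfolding as(1) by blast
    qed
    then have "as = replicate (degree m) x" using as(2) by (metis replicate_eqI)
    then have m_eq: "m = smult (lead_coeff m) ([:- x, 1:] ^ degree m)"
      using as(1) by simp
    have "poly (pderiv ([:- x, 1:] ^ degree m)) x = 0"
      using d0 \<open>degree m \<noteq> 1\<close> by (simp add: pderiv_power)
    then have "poly (pderiv m) x = 0" by (subst m_eq) (simp add: pderiv_smult)
    moreover have "pderiv m \<in> polys_over \<rat>"
      using mF(1) by (auto simp: polys_over_def coeff_pderiv intro!: Rats_mult Rats_add)
    moreover have "pderiv m \<noteq> 0" using d0 by (simp add: pderiv_eq_0_iff)
    ultimately have "degree m \<le> degree (pderiv m)" using least by blast
    then show False using d0 by (simp add: degree_pderiv)
  qed
  then obtain b where b: "poly m b = 0" "b \<noteq> x" by blast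
  have id: "embedding \<rat> (\<lambda>z. z)" by (simp add: embedding_def)
  have "poly (map_poly (\<lambda>z. z) m) b = 0" using b by simp
  from embedding_extend_simple[OF csubfield_Rats id m this]
  obtain F1 \<sigma>1 where F1: "csubfield F1" "embedding F1 \<sigma>1" "insert x \<rat> \<subseteq> F1" "\<sigma>1 x = b"
    "\<forall>E. csubfield E \<longrightarrow> insert x \<rat> \<subseteq> E \<longrightarrow> F1 \<subseteq> E" by blast
  from embedding_extend_finite[OF S F1(1,2)]
  obtain F2 \<tau> where F2: "csubfield F2" "embedding F2 \<tau>" "F1 \<union> S \<subseteq> F2" "\<forall>z\<in>F1. \<tau> z = \<sigma>1 z"
    "\<forall>E. csubfield E \<longrightarrow> F1 \<union> S \<subseteq> E \<longrightarrow> F2 \<subseteq> E" by metis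
  \<comment> \<open>Since \<open>x\<close> lies in \<open>K\<close>, adjoining it before the
    generators yields nothing outside \<open>K\<close>.\<close>
  have "F2 = K"
  proof
    show "F2 \<subseteq> K" using F2(5) F1(5) K(1,2) x(1) Rats_subset_csubfield[OF K(1)] by simp
    show "K \<subseteq> F2" using K(3)[OF F2(1)] F2(3) by blast
  qed
  moreover have "\<tau> x \<noteq> x" using F2(4) F1(3,4) b(2) by simp
  ultimately show ?thesis using F2(2) by blast
qed

section \<open>Solvable transitive groups of degree six are imprimitive\<close>

text \<open>Pure permutation group theory, kept apart from fields. The maps \<open>act g\<close> are
  constrained on \<open>R\<close> alone, because a Galois automorphism is a function on complex
  numbers of which only the values at the roots matter here.\<close>

locale faithful_degree_6 = group G for G (structure) +
  fixes act :: "'a \<Rightarrow> 'c \<Rightarrow> 'c" and R :: "'c set"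
  assumes card_R: "card R = 6"
    and act_closed: "g \<in> carrier G \<Longrightarrow> r \<in> R \<Longrightarrow> act g r \<in> R"
    and act_mult: "g \<in> carrier G \<Longrightarrow> h \<in> carrier G \<Longrightarrow> r \<in> R \<Longrightarrow> act (g \<otimes> h) r = act g (act h r)"
    and act_one: "r \<in> R \<Longrightarrow> act \<one> r = r"
    and act_transitive: "r \<in> R \<Longrightarrow> s \<in> R \<Longrightarrow> \<exists>g\<in>carrier G. act g r = s"
    and act_faithful: "g \<in> carrier G \<Longrightarrow> (\<And>r. r \<in> R \<Longrightarrow> act g r = r) \<Longrightarrow> g = \<one>"
begin

lemma finite_R: "finite R"
  using card_R by (rule_tac card_ge_0_finite) simp

definition orb :: "'a set \<Rightarrow> 'c \<Rightarrow> 'c set" where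
  "orb N r = (\<lambda>n. act n r) ` N"

lemma act_inv: "g \<in> carrier G \<Longrightarrow> r \<in> R \<Longrightarrow> act (inv g) (act g r) = r"
  using act_mult[of "inv g" g r] act_one by simp

lemma act_inj: "g \<in> carrier G \<Longrightarrow> inj_on (act g) R"
  by (rule inj_on_inverseI[of _ "act (inv g)"]) (rule act_inv)

section \<open>Orbits of a normal subgroup as blocks\<close>

context
  fixes N assumes N: "N \<lhd> G"
begin

interpretation normal N G by (rule N)

lemma N_subset: "n \<in> N \<Longrightarrow> n \<in> carrier G"
  using subset by blast

lemma orb_subset: "r \<in> R \<Longrightarrow> orb N r \<subseteq> R"
  using N_subset act_closed by (auto simp: orb_def)

lemma orb_refl: "r \<in> R \<Longrightarrow> r \<in> orb N r"
  unfolding orb_def by (rule image_eqI[of _ _ \<one>]) (simp_all add: act_one)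

lemma orb_eq:
  assumes "r \<in> R" "s \<in> orb N r"
  shows "orb N s = orb N r"
proof -
  obtain n where n: "n \<in> N" "s = act n r" using assms(2) by (auto simp: orb_def)
  have s: "s \<in> R" using n assms(1) N_subset act_closed by simp
  have sub: "orb N (act k t) \<subseteq> orb N t" if "k \<in> N" "t \<in> R" for k t
  proof
    fix u assume "u \<in> orb N (act k t)"
    then obtain l where l: "l \<in> N" "u = act l (act k t)" by (auto simp: orb_def)
    then have "u = act (l \<otimes> k) t" using that N_subset act_mult by simp
    then show "u \<in> orb N t" using l that by (simp add: orb_def)
  qed
  have "r = act (inv n) s" using n assms(1) act_inv N_subset by simp
  then show ?thesis using sub[of n r] sub[of "inv n" s] n assms(1) s by auto
qed

text \<open>Normality enters here: conjugation by \<open>g\<close> keeps elements of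
  \<open>N\<close> in \<open>N\<close>. Hence \<open>G\<close> permutes the orbits, and by
  transitivity they all have the same size.\<close>

lemma act_orb:
  assumes "g \<in> carrier G" "r \<in> R"
  shows "act g ` orb N r = orb N (act g r)"
proof
  show "act g ` orb N r \<subseteq> orb N (act g r)"
  proof
    fix u assume "u \<in> act g ` orb N r"
    then obtain n where n: "n \<in> N" "u = act g (act n r)" by (auto simp: orb_def)
    have nG: "n \<in> carrier G" using n N_subset by simp
    have k: "g \<otimes> n \<otimes> inv g \<in> N" using inv_op_closed2 assms(1) n(1) by simp
    have "act (g \<otimes> n \<otimes> inv g) (act g r) = act (g \<otimes> n \<otimes> inv g \<otimes> g) r"
      using k N_subset assms by (simp add: act_mult)
    also have "g \<otimes> n \<otimes> inv g \<otimes> g = g \<otimes> n" using assms(1) nG by (simp add: m_assoc)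
    also have "act (g \<otimes> n) r = u" using n assms nG by (simp add: act_mult)
    finally show "u \<in> orb N (act g r)" using k unfolding orb_def by force
  qed
  show "orb N (act g r) \<subseteq> act g ` orb N r"
  proof
    fix u assume "u \<in> orb N (act g r)"
    then obtain n where n: "n \<in> N" "u = act n (act g r)" by (auto simp: orb_def)
    have nG: "n \<in> carrier G" using n N_subset by simp
    have k: "inv g \<otimes> n \<otimes> g \<in> N" using inv_op_closed1 assms(1) n(1) by simp
    have "act g (act (inv g \<otimes> n \<otimes> g) r) = act (g \<otimes> (inv g \<otimes> n \<otimes> g)) r"
      using k N_subset assms by (simp add: act_mult)
    also have "g \<otimes> (inv g \<otimes> n \<otimes> g) = n \<otimes> g" using assms(1) nG by (simp add: m_assoc[symmetric])
    also have "act (n \<otimes> g) r = u" using n assms nG by (simp add: act_mult)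
    finally show "u \<in> act g ` orb N r" using k unfolding orb_def by force
  qed
qed

lemma card_orb_eq: "r \<in> R \<Longrightarrow> s \<in> R \<Longrightarrow> card (orb N r) = card (orb N s)"
proof -
  assume r: "r \<in> R" and s: "s \<in> R"
  obtain g where g: "g \<in> carrier G" "act g r = s" using act_transitive[OF r s] by blast
  have "inj_on (act g) (orb N r)" using act_inj[OF g(1)] orb_subset[OF r] inj_on_subset by blast
  then show ?thesis using act_orb[OF g(1) r] g(2) card_image by fastforce
qed

lemma Union_orbs: "\<Union> (orb N ` R) = R"
  using orb_subset orb_refl by auto

lemma disjoint_orbs:
  assumes "B \<in> orb N ` R" "C \<in> orb N ` R" "B \<noteq> C"
  shows "B \<inter> C = {}"
proof (rule ccontr)
  assume "B \<inter> C \<noteq> {}"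
  then obtain r where "r \<in> B" "r \<in> C" by blast
  then have "orb N r = B" "orb N r = C" using assms orb_eq by auto
  then show False using assms(3) by simp
qed

text \<open>The orbits partition the six points into parts of equal size.\<close>

lemma card_orb_dvd: "r \<in> R \<Longrightarrow> card (orb N r) dvd 6"
proof -
  assume r: "r \<in> R"
  have "card (orb N r) * card (orb N ` R) = card (\<Union> (orb N ` R))"
  proof (rule card_partition)
    show "card B = card (orb N r)" if B: "B \<in> orb N ` R" for B
    proof -
      obtain s where "s \<in> R" "B = orb N s" using B by blast
      then show ?thesis using card_orb_eq[of s r] r by simp
    qed
    show "finite (orb N ` R)" using finite_R by simp
    show "finite (\<Union> (orb N ` R))" unfolding Union_orbs by (rule finite_R)
  qed (rule disjoint_orbs)
  then show ?thesis using Union_orbs card_R by (metis dvd_triv_left)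
qed

text \<open>With one singleton orbit all orbits are singletons, so \<open>N\<close> acts trivially,
  against faithfulness.\<close>

lemma card_orb_ne_1:
  assumes "N \<noteq> {\<one>}" "r \<in> R"
  shows "card (orb N r) \<noteq> 1"
proof
  assume *: "card (orb N r) = 1"
  have "n = \<one>" if n: "n \<in> N" for n
  proof (rule act_faithful)
    show "n \<in> carrier G" using n N_subset by simp
    fix s assume s: "s \<in> R"
    have "card (orb N s) = 1" using * card_orb_eq[OF s assms(2)] by simp
    then obtain t where "orb N s = {t}" by (rule card_1_singletonE)
    then have "orb N s = {s}" using orb_refl[OF s] by simp
    then show "act n s = s" using n by (auto simp: orb_def)
  qed
  then show False using assms(1) one_closed by blast
qed

end

section \<open>The derived series and the block system\<close>

lemma derived_exp_normal: "(derived G ^^ n) (carrier G) \<lhd> G"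
  by (induction n) (simp_all add: normal_self derived_is_normal)

lemma derived_trivial_commute:
  assumes "derived G A = {\<one>}" "A \<subseteq> carrier G" "a \<in> A" "b \<in> A"
  shows "a \<otimes> b = b \<otimes> a"
proof -
  have G: "a \<in> carrier G" "b \<in> carrier G" using assms by auto
  have "a \<otimes> b \<otimes> inv a \<otimes> inv b \<in> derived G A"
    unfolding derived_def using assms(3,4) by (intro generate.incl) blast
  then have "a \<otimes> b \<otimes> inv a \<otimes> inv b = \<one>" using assms(1) by simp
  then have "a \<otimes> b \<otimes> inv a \<otimes> inv b \<otimes> b \<otimes> a = b \<otimes> a" using G by (simp add: m_assoc)
  then show ?thesis using G by (simp add: m_assoc)
qed

text \<open>
  The last nontrivial term of the derived series is abelian and normal. Its orbits are blocks,
  unless it is transitive; then it is regular of order six, and its elements of order at most two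
  form a smaller normal subgroup.
\<close>

lemma exists_normal_orbits_2_or_3:
  assumes "solvable G"
  shows "\<exists>N. N \<lhd> G \<and> (\<forall>r\<in>R. card (orb N r) = 2) \<or> N \<lhd> G \<and> (\<forall>r\<in>R. card (orb N r) = 3)"
proof -
  obtain r0 where r0: "r0 \<in> R" using card_R by fastforce
  have dvd6: "k = 1 \<or> k = 2 \<or> k = 3 \<or> k = 6" if "k dvd 6" for k :: nat
  proof -
    have "k \<le> 6" using that by (rule dvd_imp_le) simp
    then have "k \<in> {0, 1, 2, 3, 4, 5, 6}" by auto
    then show ?thesis using that by auto
  qed
  \<comment> \<open>A nontrivial normal subgroup that is not transitive suffices: its orbit size
    divides 6 and is neither 1 nor 6.\<close>
  have from_normal: ?thesis if N: "N \<lhd> G" "N \<noteq> {\<one>}" "card (orb N r0) \<noteq> 6" for N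
  proof -
    have "card (orb N r0) = 2 \<or> card (orb N r0) = 3"
      using dvd6[OF card_orb_dvd[OF N(1) r0]] card_orb_ne_1[OF N(1,2) r0] N(3) by auto
    then show ?thesis using card_orb_eq[OF N(1) r0] N(1) by metis
  qed
  define D where "D n = (derived G ^^ n) (carrier G)" for n
  have "\<exists>n. D n = {\<one>}" using assms solvable_iff_trivial_derived_seq by (simp add: D_def)
  then obtain n where n: "D n = {\<one>}" "\<And>k. k < n \<Longrightarrow> D k \<noteq> {\<one>}"
    using exists_least_iff[of "\<lambda>n. D n = {\<one>}"] by blast
  have "n \<noteq> 0"
  proof
    assume "n = 0"
    then have "carrier G = {\<one>}" using n(1) by (simp add: D_def)
    then have "R \<subseteq> {r0}" using act_transitive[OF r0] act_one[OF r0] by auto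
    then have "card R \<le> 1" using card_mono[of "{r0}" R] by simp
    then show False using card_R by simp
  qed
  then obtain k where k: "n = Suc k" using not0_implies_Suc by blast
  define A where "A = D k"
  have A: "A \<lhd> G" unfolding A_def D_def by (rule derived_exp_normal)
  have A1: "A \<noteq> {\<one>}" using n(2) k by (simp add: A_def)
  have "derived G A = {\<one>}" using n(1) k by (simp add: A_def D_def)
  then have comm: "a \<otimes> b = b \<otimes> a" if "a \<in> A" "b \<in> A" for a b
    using derived_trivial_commute that N_subset[OF A] by blast
  show ?thesis
  proof (cases "card (orb A r0) = 6")
    case False
    then show ?thesis using from_normal A A1 by blast
  next
    case True
    have "orb A r0 = R"
      using True card_R orb_subset[OF A r0] finite_R by (intro card_subset_eq) auto
    \<comment> \<open>A transitive abelian group is regular: an element fixing \<open>r0\<close>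
      commutes with the elements that carry \<open>r0\<close> to the other points, so it fixes these
      as well.\<close>
    have stab: "a = \<one>" if a: "a \<in> A" "act a r0 = r0" for a
    proof (rule act_faithful)
      show aG: "a \<in> carrier G" using a N_subset[OF A] by simp
      fix s assume "s \<in> R"
      then obtain b where b: "b \<in> A" "s = act b r0"
        using \<open>orb A r0 = R\<close> by (auto simp: orb_def)
      have bG: "b \<in> carrier G" using b N_subset[OF A] by simp
      have "act a s = act (a \<otimes> b) r0" using b aG bG r0 by (simp add: act_mult)
      also have "\<dots> = act b (act a r0)" using comm[OF a(1) b(1)] aG bG r0 by (simp add: act_mult)
      finally show "act a s = s" using a b by simp
    qed
    interpret A: normal A G by (rule A)
    have "inj_on (\<lambda>a. act a r0) A"
    proof (rule inj_onI)
      fix a b assume ab: "a \<in> A" "b \<in> A" "act a r0 = act b r0"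
      have G: "a \<in> carrier G" "b \<in> carrier G" using ab N_subset[OF A] by auto
      have "act (inv b \<otimes> a) r0 = r0" using ab G r0 by (simp add: act_mult act_inv)
      then have "inv b \<otimes> a = \<one>" using stab ab by simp
      then show "a = b" using G by (metis inv_closed inv_equality inv_inv)
    qed
    then have card_A: "card A = 6" using True by (simp add: orb_def card_image)
    then have fin_A: "finite A" by (rule_tac card_ge_0_finite) simp
    interpret GA: group "G\<lparr>carrier := A\<rparr>" by (rule A.subgroup_is_group) (rule is_group)
    have sub: "\<exists>H. subgroup H (G\<lparr>carrier := A\<rparr>) \<and> card H = p"
      if "prime p" "6 = p * m" for p m :: nat
      using sylow_thm[of p "G\<lparr>carrier := A\<rparr>" 1 m] that card_A fin_A GA.is_group by (simp add: Coset.order_def)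
    \<comment> \<open>Closed under multiplication because \<open>A\<close> is abelian, and normal in
      the whole group because conjugation preserves the defining equation.\<close>
    define B where "B = {a \<in> A. a \<otimes> a = \<one>}"
    have "subgroup B G"
    proof
      show "B \<subseteq> carrier G" using N_subset[OF A] by (auto simp: B_def)
      show "\<one> \<in> B" by (simp add: B_def)
      fix x assume x: "x \<in> B"
      have xG: "x \<in> carrier G" using x N_subset[OF A] by (auto simp: B_def)
      have "inv x = x" using x xG by (intro inv_equality) (auto simp: B_def)
      then show "inv x \<in> B" using x by simp
      fix y assume y: "y \<in> B"
      have yG: "y \<in> carrier G" using y N_subset[OF A] by (auto simp: B_def)
      have "x \<otimes> y \<otimes> (x \<otimes> y) = x \<otimes> (y \<otimes> x) \<otimes> y" using xG yG by (simp add: m_assoc)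
      also have "y \<otimes> x = x \<otimes> y" using comm x y by (simp add: B_def)
      also have "x \<otimes> (x \<otimes> y) \<otimes> y = (x \<otimes> x) \<otimes> (y \<otimes> y)" using xG yG by (simp add: m_assoc)
      also have "\<dots> = \<one>" using x y by (simp add: B_def)
      finally show "x \<otimes> y \<in> B" using x y by (simp add: B_def)
    qed
    moreover have "g \<otimes> h \<otimes> inv g \<in> B" if g: "g \<in> carrier G" and h: "h \<in> B" for g h
    proof -
      have hG: "h \<in> carrier G" using h N_subset[OF A] by (auto simp: B_def)
      have "g \<otimes> h \<otimes> inv g \<otimes> (g \<otimes> h \<otimes> inv g) = g \<otimes> h \<otimes> (inv g \<otimes> g) \<otimes> h \<otimes> inv g"
        using g hG by (simp only: m_assoc inv_closed m_closed)
      also have "\<dots> = g \<otimes> (h \<otimes> h) \<otimes> inv g" using g hG by (simp add: m_assoc)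
      also have "\<dots> = \<one>" using h g by (simp add: B_def)
      finally show ?thesis using A.inv_op_closed2[OF g] h by (simp add: B_def)
    qed
    ultimately have B: "B \<lhd> G" by (simp add: normal_inv_iff)
    \<comment> \<open>A Sylow 2-subgroup of \<open>A\<close> supplies an element of order 2.\<close>
    have "B \<noteq> {\<one>}"
    proof -
      obtain H where H: "subgroup H (G\<lparr>carrier := A\<rparr>)" "card H = 2" using sub[of 2 3] by auto
      have HA: "H \<subseteq> A" using subgroup.subset[OF H(1)] by simp
      have "\<one> \<in> H" using subgroup.one_closed[OF H(1)] by simp
      then have "card (H - {\<one>}) = 1" using H(2) by simp
      then obtain h where "H - {\<one>} = {h}" by (rule card_1_singletonE)
      then have h: "h \<noteq> \<one>" "H = {\<one>, h}" using \<open>\<one> \<in> H\<close> by auto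
      have hA: "h \<in> A" and hG: "h \<in> carrier G" using h HA N_subset[OF A] by auto
      have "h \<otimes> h \<in> H" using subgroup.m_closed[OF H(1), of h h] h(2) by simp
      then have "h \<otimes> h = \<one>" using h hG by auto
      then show ?thesis using h hA by (auto simp: B_def)
    qed
    \<comment> \<open>A Sylow 3-subgroup supplies an element of \<open>A\<close> outside
      \<open>B\<close>, so \<open>B\<close> has fewer than six elements and cannot be
      transitive.\<close>
    moreover have "card (orb B r0) \<noteq> 6"
    proof -
      obtain H where H: "subgroup H (G\<lparr>carrier := A\<rparr>)" "card H = 3" using sub[of 3 2] by auto
      have HA: "H \<subseteq> A" using subgroup.subset[OF H(1)] by simp
      have one: "\<one> \<in> H" using subgroup.one_closed[OF H(1)] by simp
      have "card (H - {\<one>}) = 2" using H(2) one by simp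
      then obtain c d where cd: "H - {\<one>} = {c, d}" "c \<noteq> d" by (auto simp: card_2_iff)
      have cdH: "c \<in> H" "d \<in> H" "c \<noteq> \<one>" "d \<noteq> \<one>" using cd by auto
      have G: "c \<in> carrier G" "d \<in> carrier G" using cdH HA N_subset[OF A] by auto
      \<comment> \<open>In the group with elements \<open>\<one>\<close>, \<open>c\<close>,
        \<open>d\<close> the product \<open>c \<otimes> d\<close> has to be \<open>\<one>\<close>;
        then \<open>c \<otimes> c = \<one>\<close> would give \<open>c = d\<close>.\<close>
      have "c \<otimes> d \<in> H" using subgroup.m_closed[OF H(1) cdH(1,2)] by simp
      moreover have "c \<otimes> d \<noteq> c" "c \<otimes> d \<noteq> d" using G cdH by auto
      ultimately have "c \<otimes> d = \<one>" using cd by blast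
      have "c \<notin> B"
      proof
        assume "c \<in> B"
        then have "c \<otimes> c = c \<otimes> d" using \<open>c \<otimes> d = \<one>\<close> by (simp add: B_def)
        then show False using G cd(2) by simp
      qed
      then have "B \<subset> A" using cdH HA by (auto simp: B_def)
      then have "card B < 6" using psubset_card_mono[OF fin_A] card_A by simp
      moreover have "card (orb B r0) \<le> card B"
        unfolding orb_def using \<open>B \<subset> A\<close> fin_A by (intro card_image_le) (auto intro: finite_subset)
      ultimately show ?thesis by simp
    qed
    ultimately show ?thesis using from_normal B by blast
  qed
qed

theorem exists_block_system:
  assumes "solvable G"
  shows "\<exists>P e. (e = 2 \<or> e = 3) \<and> \<Union>P = R \<and> pairwise disjnt P \<and> (\<forall>B\<in>P. card B = e) \<and>
    (\<forall>g\<in>carrier G. \<forall>B\<in>P. act g ` B \<in> P)"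
proof -
  obtain N e where N: "N \<lhd> G" "e = 2 \<or> e = 3" "\<forall>r\<in>R. card (orb N r) = e"
    using exists_normal_orbits_2_or_3[OF assms] by metis
  show ?thesis
  proof (intro exI[of _ "orb N ` R"] exI[of _ e] conjI ballI)
    show "pairwise disjnt (orb N ` R)"
      using disjoint_orbs[OF N(1)] by (simp add: pairwise_def disjnt_def)
    show "act g ` B \<in> orb N ` R" if "g \<in> carrier G" "B \<in> orb N ` R" for g B
      using that act_orb[OF N(1)] act_closed by auto
  qed (use N Union_orbs[OF N(1)] in auto)
qed

end

section \<open>The Galois group as a permutation group\<close>

lemma complex_field_simps:
  "carrier complex_field = UNIV" "x \<oplus>\<^bsub>complex_field\<^esub> y = x + y" "x \<otimes>\<^bsub>complex_field\<^esub> y = x * y"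
  "\<one>\<^bsub>complex_field\<^esub> = 1" "\<zero>\<^bsub>complex_field\<^esub> = 0"
  by (simp_all add: ring_of_type_algebra_def)

lemma complex_field_uminus: "\<ominus>\<^bsub>complex_field\<^esub> x = - x"
proof -
  interpret R: field complex_field by (rule field_from_type_algebra)
  show ?thesis by (rule R.minus_equality) (simp_all add: complex_field_simps)
qed

lemma complex_field_inverse: "x \<noteq> 0 \<Longrightarrow> inv\<^bsub>complex_field\<^esub> x = inverse x"
proof -
  assume x: "x \<noteq> 0"
  interpret R: field complex_field by (rule field_from_type_algebra)
  show ?thesis by (rule R.comm_inv_char) (use x in \<open>simp_all add: complex_field_simps\<close>)
qed

definition croots :: "rat poly \<Rightarrow> complex set" where
  "croots p = {z. poly (map_poly of_rat p) z = 0}"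

lemma csubfield_splitting_field: "csubfield (splitting_field p)"
  unfolding csubfield_def splitting_field_def
proof (intro conjI ballI)
  let ?G = "generate_field complex_field {z. poly (map_poly of_rat p) z = 0}"
  show one: "1 \<in> ?G" using generate_field.one[of complex_field] by (simp add: complex_field_simps)
  fix x assume x: "x \<in> ?G"
  show um: "- x \<in> ?G" using generate_field.a_inv[OF x] by (simp add: complex_field_uminus)
  show "inverse x \<in> ?G"
    using generate_field.m_inv[OF x] x by (cases "x = 0") (auto simp: complex_field_simps complex_field_inverse)
  fix y assume y: "y \<in> ?G"
  show "x + y \<in> ?G" using generate_field.eng_add[OF x y] by (simp add: complex_field_simps)
  show "x * y \<in> ?G" using generate_field.eng_mult[OF x y] by (simp add: complex_field_simps)
qed

lemma croots_subset_splitting_field: "croots p \<subseteq> splitting_field p"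
  unfolding croots_def splitting_field_def by (auto intro: generate_field.incl)

text \<open>Together with \<open>croots_subset_splitting_field\<close> this characterizes the
  splitting field, so that later arguments compare subfields instead of inspecting how elements are
  generated.\<close>

lemma splitting_field_least:
  assumes E: "csubfield E" and R: "croots p \<subseteq> E"
  shows "splitting_field p \<subseteq> E"
proof
  fix x assume "x \<in> splitting_field p"
  then show "x \<in> E"
    unfolding splitting_field_def
  proof (induction rule: generate_field.induct)
    case (incl h)
    then show ?case using R by (auto simp: croots_def)
  qed (simp_all add: complex_field_simps complex_field_uminus complex_field_inverse csubfieldD[OF E])
qed

text \<open>Passage between polynomials of type \<open>rat poly\<close>, for which irreducibility is
  assumed, and complex polynomials with rational coefficients, on which embeddings act.\<close>

lemma polys_over_Rats_iff: "P \<in> polys_over \<rat> \<longleftrightarrow> (\<exists>q. P = map_poly of_rat q)"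
proof
  assume P: "P \<in> polys_over \<rat>"
  define q where "q = Poly (map (the_inv of_rat) (coeffs P))"
  have inv: "of_rat (the_inv of_rat x :: rat) = x" if "x \<in> \<rat>" for x :: complex
    using that by (intro f_the_inv_into_f) (auto simp: Rats_def inj_on_def)
  have "map of_rat (map (the_inv of_rat :: complex \<Rightarrow> rat) (coeffs P)) = coeffs P"
  proof (rule nth_equalityI)
    fix i assume "i < length (map of_rat (map (the_inv of_rat :: complex \<Rightarrow> rat) (coeffs P)))"
    then have i: "i < length (coeffs P)" by simp
    then have "coeffs P ! i = coeff P i" by (rule nth_coeffs_coeff)
    then have "coeffs P ! i \<in> \<rat>" using P by (simp add: polys_over_def)
    then show "map of_rat (map (the_inv of_rat :: complex \<Rightarrow> rat) (coeffs P)) ! i = coeffs P ! i"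
      using i inv by simp
  qed simp
  then have "Poly (map of_rat (map (the_inv of_rat :: complex \<Rightarrow> rat) (coeffs P))) = P" by simp
  moreover have "map_poly of_rat (Poly xs) = Poly (map of_rat xs)" for xs :: "rat list"
    by (induction xs) (simp_all add: Polynomial.map_poly_pCons)
  ultimately show "\<exists>q. P = map_poly of_rat q" by (metis q_def)
next
  assume "\<exists>q. P = map_poly of_rat q"
  then show "P \<in> polys_over \<rat>" by (auto simp: polys_over_def coeff_map_poly)
qed

section \<open>Complex roots of irreducible rational polynomials\<close>

lemma map_poly_of_rat_mult:
  "map_poly of_rat (p * q) = map_poly of_rat p * (map_poly of_rat q :: 'a::field_char_0 poly)"
  by (rule poly_eqI) (simp add: coeff_map_poly coeff_mult of_rat_sum of_rat_mult)

lemma map_poly_of_rat_add: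
  "map_poly of_rat (p + q) = map_poly of_rat p + (map_poly of_rat q :: 'a::field_char_0 poly)"
  by (rule poly_eqI) (simp add: coeff_map_poly of_rat_add)

text \<open>Otherwise \<open>p\<close> and \<open>q\<close> are coprime, and a Bezout identity
  evaluated at the common root reads 0 = 1.\<close>

lemma irreducible_dvd_if_common_root:
  assumes p: "irreducible (p :: rat poly)"
    and r: "poly (map_poly of_rat p) r = (0 :: complex)" "poly (map_poly of_rat q) r = 0"
  shows "p dvd q"
proof (rule ccontr)
  assume "\<not> p dvd q"
  then have "coprime p q" using p by (simp add: prime_elem_imp_coprime irreducible_imp_prime_elem)
  then have "gcd p q = 1" by simp
  then obtain u v where uv: "u * p + v * q = 1" using bezout_coefficients_fst_snd[of p q] by metis
  have "map_poly of_rat (u * p + v * q) = map_poly of_rat u * map_poly of_rat p + map_poly of_rat v * (map_poly of_rat q :: complex poly)"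
    by (simp add: map_poly_of_rat_add map_poly_of_rat_mult)
  then have "poly (map_poly of_rat (u * p + v * q)) r = 0" using r by simp
  then show False by (simp add: uv)
qed

lemma croots_subset_if_common_root:
  assumes "irreducible p" "r \<in> croots p" "Q \<in> polys_over \<rat>" "poly Q r = 0"
  shows "croots p \<subseteq> {z. poly Q z = 0}"
proof -
  obtain q where q: "Q = map_poly of_rat q" using assms(3) polys_over_Rats_iff by blast
  then have "p dvd q" using irreducible_dvd_if_common_root[of p r q] assms by (simp add: croots_def)
  then obtain k where "q = p * k" by blast
  then have "Q = map_poly of_rat p * map_poly of_rat k" using q by (simp add: map_poly_of_rat_mult)
  then show ?thesis by (auto simp: croots_def)
qed

text \<open>A double root would be shared with the derivative, so \<open>p\<close> would divide a
  nonzero polynomial of smaller degree.\<close>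

lemma rsquarefree_irreducible:
  assumes "irreducible (p :: rat poly)"
  shows "rsquarefree (map_poly of_rat p :: complex poly)"
  unfolding rsquarefree_roots
proof (intro allI notI)
  fix a :: complex
  assume a: "poly (map_poly of_rat p) a = 0 \<and> poly (pderiv (map_poly of_rat p)) a = 0"
  have "pderiv (map_poly of_rat p) = (map_poly of_rat (pderiv p) :: complex poly)"
    by (simp add: of_rat_hom.map_poly_pderiv)
  then have "p dvd pderiv p" using irreducible_dvd_if_common_root[OF assms, of a "pderiv p"] a by presburger
  moreover have "p \<noteq> 0" "\<not> p dvd 1" using assms by (auto simp: irreducible_def)
  then have "degree p \<noteq> 0" by (simp add: is_unit_iff_degree)
  ultimately show False using not_dvd_pderiv[of p] by simp
qed

text \<open>Simple roots let the product run over the set of roots, the form in which it can be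
  split along blocks and permuted by automorphisms.\<close>

lemma rsquarefree_prod_roots:
  fixes P :: "complex poly"
  assumes "rsquarefree P" "lead_coeff P = 1"
  shows "P = (\<Prod>r\<in>{z. poly P z = 0}. [:-r, 1:])" and "card {z. poly P z = 0} = degree P"
proof -
  have P0: "P \<noteq> 0" using assms(1) by (simp add: rsquarefree_def)
  obtain as where as: "smult (lead_coeff P) (\<Prod>a\<leftarrow>as. [:- a, 1:]) = P" "length as = degree P"
    using fundamental_theorem_algebra_factorized[of P] by blast
  have P: "P = (\<Prod>a\<leftarrow>as. [:- a, 1:])" using as(1) assms(2) by simp
  have roots: "poly (\<Prod>a\<leftarrow>bs. [:- a, 1:]) z = 0 \<longleftrightarrow> z \<in> set bs" for bs :: "complex list" and z
    by (induction bs) auto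
  have "distinct as"
  proof (rule ccontr)
    assume "\<not> distinct as"
    then obtain xs ys zs y where "as = xs @ [y] @ ys @ [y] @ zs" using not_distinct_decomp by blast
    then have "P = [:- y, 1:] ^ 2 * ((\<Prod>a\<leftarrow>xs. [:- a, 1:]) * (\<Prod>a\<leftarrow>ys. [:- a, 1:]) * (\<Prod>a\<leftarrow>zs. [:- a, 1:]))"
      unfolding P by (simp only: map_append prod_list.append power2_eq_square list.map prod_list.Cons prod_list.Nil mult_1_left mult_1_right mult_ac)
    then have "[:- y, 1:] ^ 2 dvd P" by (metis dvd_triv_left)
    then have "order y P \<ge> 2" using order_divides[of y 2 P] P0 by blast
    moreover have "order y P = 0 \<or> order y P = 1" using assms(1) by (simp add: rsquarefree_def)
    ultimately show False by linarith
  qed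
  moreover have "{z. poly P z = 0} = set as" unfolding P roots by simp
  ultimately show "P = (\<Prod>r\<in>{z. poly P z = 0}. [:-r, 1:])" "card {z. poly P z = 0} = degree P"
    using as(2) P prod.distinct_set_conv_list[of as "\<lambda>a. [:- a, 1:]"] distinct_card[of as] by argo+
qed

section \<open>Action of embeddings on roots and on the splitting field\<close>

lemma embedding_croots:
  assumes "csubfield F" "embedding F \<sigma>" "r \<in> croots p" "r \<in> F"
  shows "\<sigma> r \<in> croots p"
proof -
  let ?P = "map_poly of_rat p :: complex poly"
  have P: "?P \<in> polys_over F"
    using Rats_subset_csubfield[OF assms(1)] by (auto simp: polys_over_def coeff_map_poly)
  have "map_poly \<sigma> ?P = ?P"
    by (rule poly_eqI) (simp add: coeff_map_embedding[OF assms(1,2)] coeff_map_poly embedding_Rats[OF assms(1,2)])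
  then have "poly ?P (\<sigma> r) = \<sigma> (poly ?P r)" using poly_map_embedding[OF assms(1,2) P assms(4)] by simp
  then show ?thesis using assms(3) embedding_0[OF assms(1,2)] by (simp add: croots_def)
qed

text \<open>Turns permutations of roots into an action on coefficients: an invariant set of roots
  gives fixed coefficients, and permuted blocks give permuted coefficients.\<close>

lemma map_embedding_prod_linear:
  assumes F: "csubfield F" and e: "embedding F \<sigma>" and B: "finite B" "B \<subseteq> F"
  shows "map_poly \<sigma> (\<Prod>t\<in>B. [:- t, 1:]) = (\<Prod>t\<in>\<sigma> ` B. [:- t, 1:])"
proof -
  have lin: "[:- u, 1:] \<in> polys_over F" if "u \<in> F" for u
    using that by (intro polys_over_pCons[OF F] polys_over_0[OF F] csubfieldD[OF F])
  have "map_poly \<sigma> (\<Prod>t\<in>B. [:- t, 1:]) = (\<Prod>t\<in>B. [:- \<sigma> t, 1:])"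
    using B
  proof (induction B rule: finite_induct)
    case empty
    then show ?case by (simp add: embedding_1[OF F e])
  next
    case (insert t B)
    have t: "t \<in> F" using insert by simp
    have B: "(\<Prod>t\<in>B. [:- t, 1:]) \<in> polys_over F"
      using insert lin by (intro polys_over_prod[OF F]) auto
    have "map_poly \<sigma> [:- t, 1:] = [:- \<sigma> t, 1:]"
      by (rule poly_eqI) (simp add: coeff_map_embedding[OF F e] coeff_pCons embedding_0[OF F e]
          embedding_1[OF F e] embedding_uminus[OF F e t] split: nat.splits)
    moreover have "map_poly \<sigma> ([:- t, 1:] * (\<Prod>t\<in>B. [:- t, 1:])) =
        map_poly \<sigma> [:- t, 1:] * map_poly \<sigma> (\<Prod>t\<in>B. [:- t, 1:])"
      by (rule map_embedding_mult[OF F e lin[OF t] B])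
    ultimately show ?case
      using insert.IH insert.prems by (simp only: prod.insert[OF insert.hyps] insert_subset simp_thms)
  qed
  also have "\<dots> = (\<Prod>t\<in>\<sigma> ` B. [:- t, 1:])"
    using inj_on_subset[OF embedding_inj[OF F e] B(2)] by (simp add: prod.reindex)
  finally show ?thesis .
qed

lemma csubfield_image:
  assumes "csubfield F" "embedding F \<sigma>"
  shows "csubfield (\<sigma> ` F)"
  unfolding csubfield_def
proof (intro conjI ballI)
  note [simp] = csubfieldD[OF assms(1)]
  show "1 \<in> \<sigma> ` F" by (rule image_eqI[of _ _ 1]) (simp_all add: embedding_1[OF assms])
  fix x assume "x \<in> \<sigma> ` F"
  then obtain u where u: "u \<in> F" "x = \<sigma> u" by blast
  show "- x \<in> \<sigma> ` F" using u by (intro image_eqI[of _ _ "- u"]) (simp_all add: embedding_uminus[OF assms])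
  show "inverse x \<in> \<sigma> ` F" using u by (intro image_eqI[of _ _ "inverse u"]) (simp_all add: embedding_inverse[OF assms])
  fix y assume "y \<in> \<sigma> ` F"
  then obtain v where v: "v \<in> F" "y = \<sigma> v" by blast
  show "x + y \<in> \<sigma> ` F" using u v by (intro image_eqI[of _ _ "u + v"]) (simp_all add: embedding_add[OF assms])
  show "x * y \<in> \<sigma> ` F" using u v by (intro image_eqI[of _ _ "u * v"]) (simp_all add: embedding_mult[OF assms])
qed

lemma csubfield_vimage:
  assumes "csubfield F" "embedding F \<sigma>" "csubfield E"
  shows "csubfield {z \<in> F. \<sigma> z \<in> E}"
  unfolding csubfield_def
  by (simp add: csubfieldD[OF assms(1)] csubfieldD[OF assms(3)] embedding_1[OF assms(1,2)]
      embedding_add[OF assms(1,2)] embedding_mult[OF assms(1,2)] embedding_uminus[OF assms(1,2)]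
      embedding_inverse[OF assms(1,2)])

lemma finite_croots: "p \<noteq> 0 \<Longrightarrow> finite (croots p)"
  unfolding croots_def by (rule poly_roots_finite) simp

lemma embedding_permutes_croots:
  assumes "p \<noteq> 0" "embedding (splitting_field p) \<sigma>"
  shows "\<sigma> ` croots p = croots p"
proof (rule card_subset_eq)
  note K = csubfield_splitting_field[of p]
  show "\<sigma> ` croots p \<subseteq> croots p"
    using embedding_croots[OF K assms(2)] croots_subset_splitting_field by blast
  show "card (\<sigma> ` croots p) = card (croots p)"
    using embedding_inj[OF K assms(2)] croots_subset_splitting_field by (intro card_image) (rule inj_on_subset)
qed (rule finite_croots[OF assms(1)])

text \<open>Preimage and image of the splitting field are subfields, and both contain all roots
  because \<open>\<sigma>\<close> permutes them. Leastness of the splitting field then gives the two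
  inclusions.\<close>

lemma embedding_splitting_field_onto:
  assumes "p \<noteq> 0" "embedding (splitting_field p) \<sigma>"
  shows "\<sigma> ` splitting_field p = splitting_field p"
proof
  note K = csubfield_splitting_field[of p]
  note perm = embedding_permutes_croots[OF assms]
  show "\<sigma> ` splitting_field p \<subseteq> splitting_field p"
    using splitting_field_least[OF csubfield_vimage[OF K assms(2) K], of p] perm
      croots_subset_splitting_field[of p] by blast
  show "splitting_field p \<subseteq> \<sigma> ` splitting_field p"
    using splitting_field_least[OF csubfield_image[OF K assms(2)], of p] perm
      croots_subset_splitting_field[of p] by blast
qed

text \<open>An embedding of the splitting field fixes the rationals and is bijective onto the field
  automatically.\<close>

lemma carrier_galois_group:
  assumes "p \<noteq> 0"
  shows "carrier (galois_group p) = {\<sigma> \<in> extensional (splitting_field p). embedding (splitting_field p) \<sigma>}"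
proof -
  define K where "K = splitting_field p"
  note K = csubfield_splitting_field[of p, folded K_def]
  let ?L = "complex_field\<lparr>carrier := K\<rparr>"
  have "\<sigma> \<in> ring_iso ?L ?L \<longleftrightarrow> embedding K \<sigma>" if "\<sigma> \<in> extensional K" for \<sigma>
  proof
    assume "\<sigma> \<in> ring_iso ?L ?L"
    then have h: "\<sigma> \<in> Ring.ring_hom ?L ?L" by (simp add: ring_iso_def)
    show "embedding K \<sigma>"
      unfolding embedding_def
      using ring_hom_add[OF h] ring_hom_mult[OF h] ring_hom_one[OF h] by (simp add: complex_field_simps)
  next
    assume e: "embedding K \<sigma>"
    have onto: "\<sigma> ` K = K" using embedding_splitting_field_onto[OF assms] e by (simp add: K_def)
    have "\<sigma> \<in> Ring.ring_hom ?L ?L"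
      using onto embedding_add[OF K e] embedding_mult[OF K e] embedding_1[OF K e]
      by (intro ring_hom_memI) (auto simp: complex_field_simps)
    moreover have "bij_betw \<sigma> K K" using embedding_inj[OF K e] onto by (simp add: bij_betw_def)
    ultimately show "\<sigma> \<in> ring_iso ?L ?L" by (simp add: ring_iso_def)
  qed
  moreover have "\<sigma> q = q" if "embedding K \<sigma>" "q \<in> \<rat>" for \<sigma> q
    using embedding_Rats[OF K that] .
  ultimately show ?thesis
    unfolding galois_group_def Let_def K_def[symmetric] by auto
qed

section \<open>Group operations, fixed field, transitivity and faithfulness\<close>

lemma mult_galois_group:
  assumes "p \<noteq> 0" "\<sigma> \<in> carrier (galois_group p)" "\<tau> \<in> carrier (galois_group p)"
  shows "\<sigma> \<otimes>\<^bsub>galois_group p\<^esub> \<tau> = compose (splitting_field p) \<sigma> \<tau>"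
proof -
  have "\<phi> \<in> Bij (splitting_field p)" if "\<phi> \<in> carrier (galois_group p)" for \<phi>
    using that by (auto simp: galois_group_def Let_def Bij_def ring_iso_def)
  then show ?thesis using assms(2,3) by (auto simp: galois_group_def Let_def BijGroup_def)
qed

lemma one_galois_group: "\<one>\<^bsub>galois_group p\<^esub> = (\<lambda>z\<in>splitting_field p. z)"
  by (simp add: galois_group_def Let_def BijGroup_def)

lemma embedding_cong:
  assumes "csubfield F" "\<And>x. x \<in> F \<Longrightarrow> \<sigma> x = \<tau> x"
  shows "embedding F \<sigma> \<longleftrightarrow> embedding F \<tau>"
  unfolding embedding_def using assms(2) by (simp add: csubfieldD[OF assms(1)])

lemma restrict_in_galois_group:
  assumes "p \<noteq> 0" "embedding (splitting_field p) \<tau>"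
  shows "restrict \<tau> (splitting_field p) \<in> carrier (galois_group p)"
proof -
  have "embedding (splitting_field p) (restrict \<tau> (splitting_field p))"
    using assms(2) embedding_cong[OF csubfield_splitting_field, of p "restrict \<tau> (splitting_field p)" \<tau>] by simp
  then show ?thesis using carrier_galois_group[OF assms(1)] by simp
qed

text \<open>An irrational element is moved by some embedding, and the restriction of that embedding
  is an automorphism.\<close>

lemma fixed_field_Rats:
  assumes "p \<noteq> 0" "x \<in> splitting_field p" "\<And>\<sigma>. \<sigma> \<in> carrier (galois_group p) \<Longrightarrow> \<sigma> x = x"
  shows "x \<in> \<rat>"
proof (rule ccontr)
  assume x: "x \<notin> \<rat>"
  have alg: "algebraic r" if "r \<in> croots p" for r
    using that assms(1) algebraicI'[of "map_poly of_rat p :: complex poly" r]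
    by (auto simp: croots_def coeff_map_poly)
  obtain \<tau> where \<tau>: "embedding (splitting_field p) \<tau>" "\<tau> x \<noteq> x"
    using embedding_moving_irrational[OF finite_croots[OF assms(1)] alg csubfield_splitting_field
        croots_subset_splitting_field splitting_field_least assms(2) x] by blast
  then show False using assms(3)[OF restrict_in_galois_group[OF assms(1) \<tau>(1)]] assms(2) by simp
qed

text \<open>Complex conjugation acts on all data attached to \<open>p\<close>; this symmetry pairs
  the complex places in the count.\<close>

lemma cnj_in_galois_group:
  assumes "p \<noteq> 0"
  shows "restrict cnj (splitting_field p) \<in> carrier (galois_group p)"
  by (rule restrict_in_galois_group[OF assms]) (simp add: embedding_def)

context
  fixes p :: "rat poly"
  assumes p: "irreducible p"
begin

lemma irreducible_nz: "p \<noteq> 0"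
  using p by auto

interpretation K: group "galois_group p" by (rule group_galois_group)

lemma galois_embedding: "\<sigma> \<in> carrier (galois_group p) \<Longrightarrow> embedding (splitting_field p) \<sigma>"
  by (simp add: carrier_galois_group[OF irreducible_nz])

text \<open>The polynomial \<open>Q\<close> whose roots form the orbit of \<open>r\<close> has
  invariant, hence rational, coefficients. It shares the root \<open>r\<close> with the irreducible
  \<open>p\<close>, so every root of \<open>p\<close> lies in the orbit.\<close>

lemma galois_group_transitive:
  assumes r: "r \<in> croots p" and s: "s \<in> croots p"
  shows "\<exists>\<sigma>\<in>carrier (galois_group p). \<sigma> r = s"
proof -
  let ?G = "carrier (galois_group p)"
  let ?K = "splitting_field p"
  note K = csubfield_splitting_field[of p]
  define Orb where "Orb = (\<lambda>\<sigma>. \<sigma> r) ` ?G"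
  have rK: "r \<in> ?K" using r croots_subset_splitting_field by blast
  have sub: "Orb \<subseteq> croots p"
    unfolding Orb_def using embedding_croots[OF K galois_embedding r rK] by blast
  have fin: "finite Orb" using sub finite_croots[OF irreducible_nz] finite_subset by blast
  have "r \<in> Orb" unfolding Orb_def
    by (rule image_eqI[OF _ K.one_closed]) (simp add: one_galois_group rK)
  define Q where "Q = (\<Prod>t\<in>Orb. [:- t, 1:])"
  have lin: "[:- t, 1:] \<in> polys_over ?K" if "t \<in> Orb" for t
    using that sub croots_subset_splitting_field[of p]
    by (intro polys_over_pCons[OF K] polys_over_0[OF K] csubfieldD[OF K]) auto
  have QK: "Q \<in> polys_over ?K" unfolding Q_def by (intro polys_over_prod[OF K] lin)
  have "map_poly \<sigma> Q = Q" if \<sigma>: "\<sigma> \<in> ?G" for \<sigma>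
  proof -
    note e = galois_embedding[OF \<sigma>]
    have "\<sigma> ` Orb = Orb"
    proof (rule card_subset_eq[OF fin])
      show "\<sigma> ` Orb \<subseteq> Orb"
      proof
        fix t assume "t \<in> \<sigma> ` Orb"
        then obtain \<tau> where \<tau>: "\<tau> \<in> ?G" "t = \<sigma> (\<tau> r)" by (auto simp: Orb_def)
        then have "t = (\<sigma> \<otimes>\<^bsub>galois_group p\<^esub> \<tau>) r"
          using mult_galois_group[OF irreducible_nz \<sigma> \<tau>(1)] rK by (simp add: compose_def)
        then show "t \<in> Orb" unfolding Orb_def using K.m_closed[OF \<sigma> \<tau>(1)] by blast
      qed
      show "card (\<sigma> ` Orb) = card Orb"
        using embedding_inj[OF K e] sub croots_subset_splitting_field[of p]
        by (intro card_image) (meson inj_on_subset)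
    qed
    then show ?thesis
      using map_embedding_prod_linear[OF K e fin] sub croots_subset_splitting_field[of p]
      unfolding Q_def by fastforce
  qed
  then have "\<sigma> (coeff Q i) = coeff Q i" if "\<sigma> \<in> ?G" for \<sigma> i
    using coeff_map_embedding[OF K galois_embedding[OF that], of Q i] that by simp
  then have "coeff Q i \<in> \<rat>" for i
    using QK fixed_field_Rats[OF irreducible_nz, of "coeff Q i"] by (simp add: polys_over_def)
  then have "Q \<in> polys_over \<rat>" by (simp add: polys_over_def)
  moreover have "poly Q r = 0" using fin \<open>r \<in> Orb\<close> by (simp add: Q_def poly_prod) 
  ultimately have "poly Q s = 0" using croots_subset_if_common_root[OF p r] s by blast
  then have "s \<in> Orb" using fin by (auto simp: Q_def poly_prod)
  then show ?thesis by (auto simp: Orb_def)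
qed

text \<open>The elements fixed by \<open>\<sigma>\<close> form a subfield containing all roots,
  hence they are the whole splitting field.\<close>

lemma galois_group_faithful:
  assumes \<sigma>: "\<sigma> \<in> carrier (galois_group p)" and fixes_roots: "\<And>r. r \<in> croots p \<Longrightarrow> \<sigma> r = r"
  shows "\<sigma> = \<one>\<^bsub>galois_group p\<^esub>"
proof -
  let ?K = "splitting_field p"
  note K = csubfield_splitting_field[of p]
  note e = galois_embedding[OF \<sigma>]
  have "csubfield {z \<in> ?K. \<sigma> z = z}"
    unfolding csubfield_def
    by (simp add: csubfieldD[OF K] embedding_1[OF K e]
      embedding_add[OF K e] embedding_mult[OF K e] embedding_uminus[OF K e] embedding_inverse[OF K e])
  then have "?K \<subseteq> {z \<in> ?K. \<sigma> z = z}"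
    using fixes_roots croots_subset_splitting_field[of p] by (intro splitting_field_least) auto
  then have id: "\<And>z. z \<in> ?K \<Longrightarrow> \<sigma> z = z" by blast
  have "\<sigma> \<in> extensional ?K" using \<sigma> carrier_galois_group[OF irreducible_nz] by simp
  then show ?thesis unfolding one_galois_group using id
    by (intro extensionalityI[of \<sigma> ?K]) auto
qed

lemma galois_group_faithful_degree_6:
  assumes "card (croots p) = 6"
  shows "faithful_degree_6 (galois_group p) (\<lambda>\<sigma>. \<sigma>) (croots p)"
proof
  note K = csubfield_splitting_field[of p]
  have rK: "r \<in> splitting_field p" if "r \<in> croots p" for r
    using that croots_subset_splitting_field by blast
  show "\<sigma> r \<in> croots p" if "\<sigma> \<in> carrier (galois_group p)" "r \<in> croots p" for \<sigma> r
    using embedding_croots[OF K galois_embedding[OF that(1)] that(2) rK[OF that(2)]] .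
  show "(\<sigma> \<otimes>\<^bsub>galois_group p\<^esub> \<tau>) r = \<sigma> (\<tau> r)"
    if "\<sigma> \<in> carrier (galois_group p)" "\<tau> \<in> carrier (galois_group p)" "r \<in> croots p" for \<sigma> \<tau> r
    using mult_galois_group[OF irreducible_nz that(1,2)] rK[OF that(3)] by (simp add: compose_def)
  show "\<one>\<^bsub>galois_group p\<^esub> r = r" if "r \<in> croots p" for r
    using rK[OF that] by (simp add: one_galois_group)
qed (use assms galois_group_transitive galois_group_faithful in auto)

end

section \<open>Factoring a sextic along a block system\<close>

text \<open>A complete set of conjugates, as seen by rational polynomials.\<close>
definition conjugate_set :: "complex set \<Rightarrow> bool" where
  "conjugate_set A \<longleftrightarrow> finite A \<and> cnj ` A = A \<and> (\<Prod>a\<in>A. [:- a, 1:]) \<in> polys_over \<int> \<and>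
     (\<forall>h\<in>polys_over \<rat>. (\<Prod>a\<in>A. poly h a) \<in> \<rat> \<and>
        ((\<exists>a\<in>A. poly h a = 0) \<longrightarrow> (\<forall>a\<in>A. poly h a = 0)))"

text \<open>
  For the conjugates \<open>A\<close> of a generator \<open>\<alpha>\<close> of a number field, an integer \<open>\<beta> = h(\<alpha>)\<close> of the field is
  represented by its tuple of conjugates, indexed by \<open>A\<close>.
\<close>
definition integers_on :: "complex set \<Rightarrow> (complex \<Rightarrow> complex) set" where
  "integers_on A = {\<beta> \<in> extensional A. (\<forall>a\<in>A. algebraic_int (\<beta> a)) \<and>
     (\<exists>h\<in>polys_over \<rat>. \<forall>a\<in>A. \<beta> a = poly h a)}"

text \<open>Without absolute values the product is the norm of \<open>\<beta> - \<gamma>\<close>. It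
  is rational since \<open>A\<close> is a conjugate set, an algebraic integer as a product of such,
  and nonzero since one vanishing factor would make all of them vanish. So it is a nonzero
  integer.\<close>

lemma integers_on_separated:
  assumes A: "conjugate_set A" and \<beta>: "\<beta> \<in> integers_on A" "\<gamma> \<in> integers_on A" "\<beta> \<noteq> \<gamma>"
  shows "1 \<le> (\<Prod>a\<in>A. cmod (\<beta> a - \<gamma> a))"
proof -
  obtain h k where h: "h \<in> polys_over \<rat>" "\<And>a. a \<in> A \<Longrightarrow> \<beta> a = poly h a"
    and k: "k \<in> polys_over \<rat>" "\<And>a. a \<in> A \<Longrightarrow> \<gamma> a = poly k a"
    using \<beta>(1,2) by (auto simp: integers_on_def)
  have d: "h - k \<in> polys_over \<rat>" using polys_over_diff[OF csubfield_Rats h(1) k(1)] .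
  have eq: "(\<Prod>a\<in>A. \<beta> a - \<gamma> a) = (\<Prod>a\<in>A. poly (h - k) a)"
    using h k by (intro prod.cong) auto
  have "(\<Prod>a\<in>A. \<beta> a - \<gamma> a) \<in> \<rat>" unfolding eq using A d by (auto simp: conjugate_set_def)
  moreover have "algebraic_int (\<Prod>a\<in>A. \<beta> a - \<gamma> a)"
    using \<beta>(1,2) by (intro algebraic_int_prod algebraic_int_diff) (auto simp: integers_on_def)
  ultimately have "(\<Prod>a\<in>A. \<beta> a - \<gamma> a) \<in> \<int>" using rational_algebraic_int_is_int by blast
  then obtain n where n: "(\<Prod>a\<in>A. \<beta> a - \<gamma> a) = of_int n" by (auto elim: Ints_cases)
  have "n \<noteq> 0"
  proof
    assume "n = 0"
    then have "\<exists>a\<in>A. poly (h - k) a = 0" using n eq A by (auto simp: conjugate_set_def)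
    then have "\<forall>a\<in>A. poly (h - k) a = 0" using A d by (auto simp: conjugate_set_def)
    then have "\<beta> = \<gamma>" using \<beta>(1,2) h k by (intro extensionalityI[of _ A]) (auto simp: integers_on_def)
    then show False using \<beta>(3) by simp
  qed
  then have "1 \<le> \<bar>n\<bar>" by simp
  also have "real_of_int \<bar>n\<bar> = cmod (\<Prod>a\<in>A. \<beta> a - \<gamma> a)" by (simp add: n)
  finally show ?thesis by (simp add: prod_norm)
qed

section \<open>Conjugation symmetry, interpolation and sizes of coefficients\<close>

lemma cnj_poly_Rats: "h \<in> polys_over \<rat> \<Longrightarrow> cnj (poly h z) = poly h (cnj z)"
proof -
  assume h: "h \<in> polys_over \<rat>"
  have F: "csubfield UNIV" by (simp add: csubfield_def)
  have e: "embedding UNIV cnj" by (simp add: embedding_def)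
  have "map_poly cnj h = h"
    using h embedding_Rats[OF F e] by (intro poly_eqI) (auto simp: coeff_map_poly polys_over_def)
  then show ?thesis using poly_map_embedding[OF F e, of h z] by (simp add: polys_over_def)
qed

text \<open>Rational coefficients commute with conjugation. Hence the value at a complex place
  determines the value at the conjugate place.\<close>

lemma integers_on_cnj:
  assumes "conjugate_set A" "\<beta> \<in> integers_on A" "a \<in> A"
  shows "\<beta> (cnj a) = cnj (\<beta> a)"
proof -
  have "cnj a \<in> A" using assms(1,3) by (auto simp: conjugate_set_def)
  then show ?thesis using assms(2,3) cnj_poly_Rats by (auto simp: integers_on_def)
qed

text \<open>Newton interpolation: a multiple of the polynomial vanishing at the earlier points
  corrects the value at the new one. Bounding the degree through coefficients also covers the empty
  set, where the polynomial has to be zero.\<close>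

lemma interpolation_over:
  assumes F: "csubfield F" and A: "finite A" "A \<subseteq> F" and \<phi>: "\<And>a. a \<in> A \<Longrightarrow> \<phi> a \<in> F"
  shows "\<exists>h\<in>polys_over F. (\<forall>i\<ge>card A. coeff h i = 0) \<and> (\<forall>a\<in>A. poly h a = \<phi> a)"
  using A \<phi>
proof (induction A rule: finite_induct)
  case empty
  show ?case using polys_over_0[OF F] by (intro bexI[of _ 0]) auto
next
  case (insert x A)
  obtain h where h: "h \<in> polys_over F" "\<And>i. i \<ge> card A \<Longrightarrow> coeff h i = 0" "\<And>a. a \<in> A \<Longrightarrow> poly h a = \<phi> a"
    using insert.IH insert.prems by auto
  define Q where "Q = (\<Prod>a\<in>A. [:- a, 1:])"
  have QF: "Q \<in> polys_over F" unfolding Q_def using insert.prems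
    by (intro polys_over_prod[OF F] polys_over_pCons[OF F] polys_over_0[OF F] csubfieldD[OF F]) auto
  have "degree Q = card A" unfolding Q_def by (subst degree_prod_eq_sum_degree) auto
  then have Qc: "coeff Q i = 0" if "i > card A" for i using that by (simp add: coeff_eq_0)
  have Qx: "poly Q x \<noteq> 0" using insert.hyps by (simp add: Q_def poly_prod)
  have QA: "poly Q a = 0" if "a \<in> A" for a using that insert.hyps by (auto simp: Q_def poly_prod)
  define c where "c = (\<phi> x - poly h x) / poly Q x"
  have c: "c \<in> F" unfolding c_def using insert.prems h(1) QF
    by (intro csubfieldD[OF F] polys_over_poly[OF F]) auto
  show ?case
  proof (intro bexI[of _ "h + [:c:] * Q"] conjI allI impI ballI)
    show "h + [:c:] * Q \<in> polys_over F"
      using h(1) QF c by (intro polys_over_add[OF F] polys_over_mult[OF F] polys_over_pCons[OF F] polys_over_0[OF F])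
    show "coeff (h + [:c:] * Q) i = 0" if "i \<ge> card (insert x A)" for i
      using that h(2)[of i] Qc[of i] insert.hyps by simp
    show "poly (h + [:c:] * Q) a = \<phi> a" if "a \<in> insert x A" for a
      using that Qx QA h(3) by (auto simp: c_def)
  qed
qed

text \<open>Uniqueness in interpolation; by it the interpolating polynomial inherits every symmetry
  of its data.\<close>

lemma poly_eq_if_agree:
  fixes h k :: "complex poly"
  assumes "finite A" "\<And>i. i \<ge> card A \<Longrightarrow> coeff h i = 0" "\<And>i. i \<ge> card A \<Longrightarrow> coeff k i = 0"
    "\<And>a. a \<in> A \<Longrightarrow> poly h a = poly k a"
  shows "h = k"
proof (rule ccontr)
  assume "h \<noteq> k"
  then have nz: "h - k \<noteq> 0" by simp
  have "degree (h - k) < card A"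
  proof (rule ccontr)
    assume "\<not> degree (h - k) < card A"
    then have "lead_coeff (h - k) = 0" using assms(2,3) by simp
    then show False using nz leading_coeff_0_iff by blast
  qed
  moreover have "A \<subseteq> {a. poly (h - k) a = 0}" using assms(4) by auto
  then have "card A \<le> card {a. poly (h - k) a = 0}" using poly_roots_finite[OF nz] card_mono by blast
  ultimately show False using card_poly_roots_bound[OF nz] by simp
qed

text \<open>A new factor \<open>[:- x, 1:]\<close> adds \<open>- x\<close> times the old
  coefficients to a shifted copy of them, so the bound grows by the factor
  \<open>1 + cmod x\<close>.\<close>

lemma norm_coeff_prod_linear_le:
  "finite B \<Longrightarrow> cmod (coeff (\<Prod>r\<in>B. [:- r, 1:]) j) \<le> (\<Prod>r\<in>B. 1 + cmod r)"
proof (induction B arbitrary: j rule: finite_induct)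
  case empty
  then show ?case by (cases j) (simp_all add: coeff_1)
next
  case (insert x B)
  define Q where "Q = (\<Prod>r\<in>B. [:- r, 1:])"
  define M where "M = (\<Prod>r\<in>B. 1 + cmod r)"
  have M: "cmod (coeff Q i) \<le> M" for i using insert.IH by (simp add: Q_def M_def)
  have "coeff ([:- x, 1:] * Q) j = - x * coeff Q j + (case j of 0 \<Rightarrow> 0 | Suc i \<Rightarrow> coeff Q i)"
    by (cases j) auto
  then have "cmod (coeff ([:- x, 1:] * Q) j) \<le> cmod x * cmod (coeff Q j) + cmod (case j of 0 \<Rightarrow> 0 | Suc i \<Rightarrow> coeff Q i)"
    by (metis norm_minus_cancel norm_mult norm_triangle_ineq)
  also have "\<dots> \<le> cmod x * M + M"
    using M order_trans[OF norm_ge_zero M[of 0]] by (intro add_mono mult_left_mono) (auto split: nat.splits)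
  finally show ?case
    unfolding prod.insert[OF insert.hyps] Q_def[symmetric] M_def[symmetric] by (simp add: ring_distribs add.commute)
qed

text \<open>\<open>192 = 2 ^ 6 * 3\<close>: replacing \<open>1 + cmod r\<close> by
  \<open>2 * max 1 (cmod r)\<close> at six roots costs \<open>2 ^ 6\<close>, and Landau's inequality
  bounds the Mahler measure by the Euclidean norm of the seven coefficients, at most
  \<open>sqrt 7 * H \<le> 3 * H\<close>.\<close>

lemma prod_roots_le:
  fixes f :: "int poly"
  assumes H: "H \<ge> 1" and deg: "degree f = 6" and c: "\<And>i. \<bar>real_of_int (coeff f i)\<bar> \<le> H"
    and R: "finite R" "map_poly of_int f = (\<Prod>r\<in>R. [:- r, 1:])"
  shows "(\<Prod>r\<in>R. 1 + cmod r) \<le> 192 * H"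
proof -
  obtain as where as: "set as = R" "distinct as" using finite_distinct_list[OF R(1)] by blast
  have P: "map_poly of_int f = smult 1 (\<Prod>a\<leftarrow>as. [:- a, 1:])"
    using R(2) prod.distinct_set_conv_list[OF as(2), of "\<lambda>a. [:- a, 1:]"] as(1) by simp
  have mm: "mahler_measure f = (\<Prod>r\<in>R. max 1 (cmod r))"
    unfolding mahler_measure_def P mahler_measure_poly_explicit
    using prod.distinct_set_conv_list[OF as(2), of "\<lambda>a. max 1 (cmod a)"] as(1) by simp
  have "real_of_int (\<Sum>a\<leftarrow>xs. a * a) \<le> real (length xs) * H\<^sup>2"
    if "\<And>a. a \<in> set xs \<Longrightarrow> \<bar>real_of_int a\<bar> \<le> H" for xs
    using that
  proof (induction xs)
    case (Cons a xs)
    have "real_of_int (a * a) \<le> H\<^sup>2"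
      using Cons.prems[of a] power_mono[of "\<bar>real_of_int a\<bar>" H 2] by (simp add: power2_eq_square)
    then show ?case using Cons by (simp add: ring_distribs)
  qed simp
  moreover have "\<bar>real_of_int a\<bar> \<le> H" if "a \<in> set (coeffs f)" for a
    using that c by (auto simp: coeffs_def split: if_splits)
  moreover have "length (coeffs f) = 7" using deg length_coeffs_degree[of f] by (cases "f = 0") auto
  ultimately have "real_of_int (\<Sum>a\<leftarrow>coeffs f. a * a) \<le> 7 * H\<^sup>2" by (metis of_nat_numeral)
  also have "\<dots> \<le> (3 * H)\<^sup>2" by (simp add: power2_eq_square)
  finally have "sqrt (real_of_int (\<Sum>a\<leftarrow>coeffs f. a * a)) \<le> 3 * H" using H by (intro real_le_lsqrt) auto
  then have mm3: "(\<Prod>r\<in>R. max 1 (cmod r)) \<le> 3 * H" using Landau_inequality_mahler_measure[of f] mm by simp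
  have "card R = degree (map_poly of_int f :: complex poly)"
    unfolding R(2) by (subst degree_prod_eq_sum_degree) auto
  then have cR: "card R = 6" using deg by (simp add: degree_map_poly)
  have "(\<Prod>r\<in>R. 1 + cmod r) \<le> (\<Prod>r\<in>R. 2 * max 1 (cmod r))" by (intro prod_mono) auto
  also have "\<dots> = 64 * (\<Prod>r\<in>R. max 1 (cmod r))" by (simp add: prod.distrib cR)
  also have "\<dots> \<le> 64 * (3 * H)" using mm3 by simp
  finally show ?thesis by simp
qed

lemma monic_eq_sum_monom:
  fixes q :: "complex poly"
  assumes "degree q = e" "lead_coeff q = 1"
  shows "q = monom 1 e + (\<Sum>j<e. monom (coeff q j) j)"
  using assms by (subst poly_as_sum_of_monoms[symmetric]) (simp add: lessThan_Suc_atMost[symmetric] add.commute)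

text \<open>
  \<open>A\<close> indexes the blocks by one distinguishing coefficient of the block factors, whose other
  coefficients become functions on \<open>A\<close>. Since the number of blocks is at most \<open>3\<close>, a coefficient
  that is not constant on the blocks is injective.
\<close>

theorem solvable_sextic_factorization:
  assumes f: "f \<in> solvable_sextics H" and H: "H \<ge> 1"
  shows "\<exists>e A b M. (e = 2 \<or> e = 3) \<and> card A * e = 6 \<and> conjugate_set A \<and>
    (\<forall>j<e. b j \<in> integers_on A) \<and> (\<exists>j<e. \<forall>a\<in>A. b j a = a) \<and>
    map_poly of_int f = (\<Prod>a\<in>A. monom 1 e + (\<Sum>j<e. monom (b j a) j)) \<and>
    (\<forall>a\<in>A. 1 \<le> M a \<and> M (cnj a) = M a \<and> (\<forall>j<e. cmod (b j a) \<le> M a)) \<and> (\<Prod>a\<in>A. M a) \<le> 192 * H"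
proof -
  define p where "p = map_poly rat_of_int f"
  have deg: "degree f = 6" and monic: "lead_coeff f = 1" and irr: "irreducible p"
    and solv: "solvable (galois_group p)" and coef: "\<And>i. \<bar>real_of_int (coeff f i)\<bar> \<le> H"
    using f by (auto simp: solvable_sextics_def solvable_poly_def p_def abs_le_iff minus_le_iff)
  have Pf: "map_poly of_rat p = (map_poly of_int f :: complex poly)"
    by (rule poly_eqI) (simp add: p_def coeff_map_poly)
  define R where "R = croots p"
  define K where "K = splitting_field p"
  define G where "G = carrier (galois_group p)"
  have p0: "p \<noteq> 0" using irr by auto
  have K: "csubfield K" unfolding K_def by (rule csubfield_splitting_field)
  have RK: "R \<subseteq> K" unfolding R_def K_def by (rule croots_subset_splitting_field)
  have e: "embedding K \<sigma>" if "\<sigma> \<in> G" for \<sigma>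
    using galois_embedding[OF irr] that by (simp add: G_def K_def)
  have fixedQ: "x \<in> \<rat>" if "x \<in> K" "\<And>\<sigma>. \<sigma> \<in> G \<Longrightarrow> \<sigma> x = x" for x
    using fixed_field_Rats[OF p0, of x] that by (simp add: G_def K_def)
  have finR: "finite R" unfolding R_def by (rule finite_croots[OF p0])
  have sqf: "rsquarefree (map_poly of_int f :: complex poly)"
    using rsquarefree_irreducible[OF irr] by (simp add: Pf)
  have lcP: "lead_coeff (map_poly of_int f :: complex poly) = 1" "degree (map_poly of_int f :: complex poly) = 6"
    using monic deg by (simp_all add: degree_map_poly coeff_map_poly)
  have R_roots: "R = {z. poly (map_poly of_int f) z = 0}" by (simp add: R_def croots_def Pf)
  have PR: "map_poly of_int f = (\<Prod>r\<in>R. [:- r, 1:])"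
    unfolding R_roots by (rule rsquarefree_prod_roots(1)[OF sqf lcP(1)])
  have cardR: "card R = 6"
    unfolding R_roots using rsquarefree_prod_roots(2)[OF sqf lcP(1)] lcP(2) by simp
  interpret act: faithful_degree_6 "galois_group p" "\<lambda>\<sigma>. \<sigma>" R
    using galois_group_faithful_degree_6[OF irr] cardR by (simp add: R_def)
  obtain P d where d: "d = 2 \<or> d = 3" and UP: "\<Union>P = R" and disj: "pairwise disjnt P"
    and cardB: "\<And>B. B \<in> P \<Longrightarrow> card B = d" and imP: "\<And>\<sigma> B. \<sigma> \<in> G \<Longrightarrow> B \<in> P \<Longrightarrow> \<sigma> ` B \<in> P"
    using act.exists_block_system[OF solv] unfolding G_def by blast
  have finP: "finite P" using UP finR finite_UnionD by blast
  have BR: "B \<subseteq> R" if "B \<in> P" for B using UP that by blast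
  have finB: "finite B" if "B \<in> P" for B using BR[OF that] finR finite_subset by blast
  have cardP: "card P * d = 6"
  proof -
    have "card (\<Union>P) = (\<Sum>B\<in>P. card B)"
      using disj finB by (intro card_Union_disjoint) (auto simp: pairwise_def disjnt_def)
    then show ?thesis using cardB UP cardR by simp
  qed
  have neB: "B \<noteq> {}" if "B \<in> P" for B using cardB[OF that] d by auto
  \<comment> \<open>Blocks that meet coincide, so an automorphism taking one root of
    \<open>B\<close> into \<open>C\<close> takes the whole block to \<open>C\<close>.\<close>
  have transP: "\<exists>\<sigma>\<in>G. \<sigma> ` B = C" if BC: "B \<in> P" "C \<in> P" for B C
  proof -
    obtain r s where rs: "r \<in> B" "s \<in> C" using neB BC by blast
    then obtain \<sigma> where \<sigma>: "\<sigma> \<in> G" "\<sigma> r = s"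
      using act.act_transitive[of r s] BR BC unfolding G_def by blast
    have "s \<in> \<sigma> ` B" "s \<in> C" using rs \<sigma> by blast+
    then have "\<not> disjnt (\<sigma> ` B) C" by (auto simp: disjnt_iff)
    then have "\<sigma> ` B = C" using pairwiseD[OF disj imP[OF \<sigma>(1) BC(1)] BC(2)] by blast
    then show ?thesis using \<sigma> by blast
  qed
  \<comment> \<open>\<open>g B\<close> is the conjugate factor of \<open>f\<close> that belongs to
    the block \<open>B\<close>.\<close>
  define g where "g B = (\<Prod>r\<in>B. [:- r, 1:])" for B :: "complex set"
  define c where "c j B = coeff (g B) j" for j B
  have gK: "g B \<in> polys_over K" if "B \<in> P" for B
    unfolding g_def using BR[OF that] RK
    by (intro polys_over_prod[OF K] polys_over_pCons[OF K] polys_over_0[OF K] csubfieldD[OF K]) auto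
  have cK: "c j B \<in> K" if "B \<in> P" for j B using gK[OF that] by (simp add: polys_over_def c_def)
  have \<sigma>c: "\<sigma> (c j B) = c j (\<sigma> ` B)" if "\<sigma> \<in> G" "B \<in> P" for \<sigma> j B
  proof -
    have "map_poly \<sigma> (g B) = g (\<sigma> ` B)"
      unfolding g_def using map_embedding_prod_linear[OF K e[OF that(1)] finB[OF that(2)]] BR[OF that(2)] RK by blast
    then show ?thesis using coeff_map_embedding[OF K e[OF that(1)], of "g B" j] by (simp add: c_def)
  qed
  have degg: "degree (g B) = d" if "B \<in> P" for B
    unfolding g_def using cardB[OF that] by (subst degree_prod_eq_sum_degree) auto
  have lcg: "lead_coeff (g B) = 1" for B unfolding g_def by (simp only: lead_coeff_prod) simp
  have g_eq: "g B = monom 1 d + (\<Sum>j<d. monom (c j B) j)" if "B \<in> P" for B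
    using monic_eq_sum_monom[OF degg[OF that] lcg] by (simp add: c_def)
  have Pg: "map_poly of_int f = (\<Prod>B\<in>P. g B)"
  proof -
    have "(\<Prod>r\<in>\<Union>P. [:- r, 1:]) = (\<Prod>B\<in>P. \<Prod>r\<in>B. [:- r, 1:])"
      using finB disj by (intro prod.Union_disjoint[unfolded o_def]) (auto simp: pairwise_def disjnt_def)
    then show ?thesis using PR UP by (simp add: g_def)
  qed
  have g_inj: "B = C" if "B \<in> P" "C \<in> P" "g B = g C" for B C
  proof -
    have "{z. poly (g B) z = 0} = B" if "B \<in> P" for B
      using finB[OF that] by (auto simp: g_def poly_prod)
    then show ?thesis using that by metis
  qed
  \<comment> \<open>If no coefficient separated the blocks, all coefficients would be constant and
    the factors of at least two different blocks would coincide.\<close>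
  have "\<exists>j0<d. inj_on (c j0) P"
  proof (rule ccontr)
    assume no: "\<not> ?thesis"
    \<comment> \<open>A value shared by \<open>D\<close> and \<open>D'\<close> but not by
      \<open>E\<close> is carried, by an automorphism taking \<open>D\<close> to \<open>E\<close>,
      to a value shared by \<open>E\<close> and a further block \<open>E'\<close>. These four blocks
      are distinct, but there are at most three.\<close>
    have const: "c j B = c j C" if jBC: "j < d" "B \<in> P" "C \<in> P" for j B C
    proof (rule ccontr)
      assume ne: "c j B \<noteq> c j C"
      have "\<not> inj_on (c j) P" using no jBC(1) by blast
      then obtain D D' where D: "D \<in> P" "D' \<in> P" "D \<noteq> D'" "c j D = c j D'"
        unfolding inj_on_def by blast
      obtain E where E: "E \<in> P" "c j E \<noteq> c j D" using ne jBC(2,3) by metis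
      obtain \<sigma> where \<sigma>: "\<sigma> \<in> G" "\<sigma> ` D = E" using transP[OF D(1) E(1)] by blast
      define E' where "E' = \<sigma> ` D'"
      have E': "E' \<in> P" using imP \<sigma> D by (simp add: E'_def)
      have "c j E' = c j E" using \<sigma>c[OF \<sigma>(1)] D \<sigma>(2) unfolding E'_def by metis
      moreover have "E' \<noteq> E"
      proof
        assume "E' = E"
        then have "\<sigma> ` D' = \<sigma> ` D" using \<sigma>(2) by (simp add: E'_def)
        moreover have "inj_on \<sigma> R" using act.act_inj \<sigma>(1) by (simp add: G_def)
        ultimately have "D' = D" using BR D by (metis inj_on_image_eq_iff)
        then show False using D by simp
      qed
      ultimately have "distinct [D, D', E, E']" using D(3,4) E(2) by (simp; metis)
      then have "card {D, D', E, E'} = 4" using distinct_card[of "[D, D', E, E']"] by simp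
      moreover have "card {D, D', E, E'} \<le> card P" using D E E' finP by (intro card_mono) auto
      ultimately show False using cardP d by auto
    qed
    have "card P \<ge> 2" using cardP d by auto
    then obtain B C where BC: "B \<in> P" "C \<in> P" "B \<noteq> C"
      by (metis card_le_Suc0_iff_eq finP not_less_eq_eq numeral_2_eq_2)
    then have "g B = g C" using g_eq const by (metis (no_types, lifting) lessThan_iff sum.cong)
    then show False using g_inj BC by blast
  qed
  then obtain j0 where j0: "j0 < d" "inj_on (c j0) P" by blast
  \<comment> \<open>The generator is the coefficient of index \<open>j0\<close>; its conjugates are
    the values at the blocks, and \<open>blk\<close> recovers the block from the value.\<close>
  define A where "A = c j0 ` P"
  define blk where "blk = the_inv_into P (c j0)"
  have blkP: "blk a \<in> P" if "a \<in> A" for a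
    unfolding blk_def using that j0(2) by (intro the_inv_into_into) (auto simp: A_def)
  have c_blk: "c j0 (blk a) = a" if "a \<in> A" for a
    unfolding blk_def using that j0(2) by (intro f_the_inv_into_f) (auto simp: A_def)
  have blk_c: "blk (c j0 B) = B" if "B \<in> P" for B
    unfolding blk_def using that j0(2) by (intro the_inv_into_f_f)
  have bijA: "bij_betw blk A P"
    by (rule bij_betwI[of _ _ _ "c j0"]) (auto simp: blkP c_blk blk_c A_def)
  have finA: "finite A" using finP by (simp add: A_def)
  have AK: "A \<subseteq> K" using cK by (auto simp: A_def)
  have \<sigma>A: "\<sigma> a \<in> A" and \<sigma>blk: "blk (\<sigma> a) = \<sigma> ` blk a" if "\<sigma> \<in> G" "a \<in> A" for \<sigma> a
  proof -
    have "\<sigma> a = c j0 (\<sigma> ` blk a)" using \<sigma>c[OF that(1) blkP[OF that(2)], of j0] c_blk[OF that(2)] by simp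
    then show "\<sigma> a \<in> A" "blk (\<sigma> a) = \<sigma> ` blk a"
      using imP[OF that(1) blkP[OF that(2)]] blk_c by (auto simp: A_def)
  qed
  have injA: "inj_on \<sigma> A" if "\<sigma> \<in> G" for \<sigma>
    using inj_on_subset[OF embedding_inj[OF K e[OF that]] AK] .
  have \<sigma>A_eq: "\<sigma> ` A = A" if "\<sigma> \<in> G" for \<sigma>
    using \<sigma>A[OF that] injA[OF that] by (intro card_subset_eq[OF finA]) (auto simp: card_image)
  have transA: "\<exists>\<sigma>\<in>G. \<sigma> a = a'" if a: "a \<in> A" "a' \<in> A" for a a'
  proof -
    obtain \<sigma> where "\<sigma> \<in> G" "\<sigma> ` blk a = blk a'" using transP[OF blkP blkP] a by blast
    then show ?thesis using \<sigma>c[of \<sigma> "blk a" j0] blkP c_blk a by metis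
  qed
  have \<sigma>h: "\<sigma> (poly h a) = poly h (\<sigma> a)" if "\<sigma> \<in> G" "h \<in> polys_over \<rat>" "a \<in> K" for \<sigma> h a
  proof -
    have "h \<in> polys_over K" using that(2) Rats_subset_csubfield[OF K] by (auto simp: polys_over_def)
    moreover have "map_poly \<sigma> h = h"
      using that(2) embedding_Rats[OF K e[OF that(1)]]
      by (intro poly_eqI) (auto simp: coeff_map_embedding[OF K e[OF that(1)]] polys_over_def)
    ultimately show ?thesis using poly_map_embedding[OF K e[OF that(1)] _ that(3)] by simp
  qed
  have cnjG: "restrict cnj K \<in> G" unfolding G_def K_def by (rule cnj_in_galois_group[OF p0])
  have "restrict cnj K ` A = cnj ` A" using AK by (intro image_cong) auto
  then have cnjA: "cnj ` A = A" using \<sigma>A_eq[OF cnjG] by argo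
  have algR: "algebraic_int r" if "r \<in> R" for r
    using that monic unfolding R_roots algebraic_int_altdef_ipoly by blast
  have alg_c: "algebraic_int (c j B)" if "B \<in> P" for j B
    unfolding c_def g_def using algR BR[OF that] by (intro algebraic_int_coeff_prod_linear finB[OF that]) auto
  have conj: "conjugate_set A"
    unfolding conjugate_set_def
  proof (intro conjI ballI impI)
    show "finite A" "cnj ` A = A" by (rule finA, rule cnjA)
    define Q where "Q = (\<Prod>a\<in>A. [:- a, 1:])"
    have QK: "Q \<in> polys_over K" unfolding Q_def using AK
      by (intro polys_over_prod[OF K] polys_over_pCons[OF K] polys_over_0[OF K] csubfieldD[OF K]) auto
    \<comment> \<open>Invariance under the group makes the coefficient rational, and a rational
      algebraic integer is an integer.\<close>
    have "coeff Q i \<in> \<int>" for i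
    proof (rule rational_algebraic_int_is_int)
      show "algebraic_int (coeff Q i)" unfolding Q_def
        using alg_c by (intro algebraic_int_coeff_prod_linear finA) (auto simp: A_def)
      show "coeff Q i \<in> \<rat>"
      proof (rule fixedQ)
        show "coeff Q i \<in> K" using QK by (simp add: polys_over_def)
        fix \<sigma> assume \<sigma>: "\<sigma> \<in> G"
        have "map_poly \<sigma> Q = Q"
          using map_embedding_prod_linear[OF K e[OF \<sigma>] finA AK] \<sigma>A_eq[OF \<sigma>] by (simp only: Q_def)
        then show "\<sigma> (coeff Q i) = coeff Q i" using coeff_map_embedding[OF K e[OF \<sigma>], of Q i] by simp
      qed
    qed
    then show "(\<Prod>a\<in>A. [:- a, 1:]) \<in> polys_over \<int>" by (simp add: polys_over_def Q_def)
    fix h :: "complex poly" assume h: "h \<in> polys_over \<rat>"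
    have hK: "poly h a \<in> K" if "a \<in> K" for a
      using h that Rats_subset_csubfield[OF K] by (intro polys_over_poly[OF K]) (auto simp: polys_over_def)
    show "(\<Prod>a\<in>A. poly h a) \<in> \<rat>"
    proof (rule fixedQ)
      show "(\<Prod>a\<in>A. poly h a) \<in> K" using hK AK by (intro csubfield_prod[OF K]) auto
      fix \<sigma> assume \<sigma>: "\<sigma> \<in> G"
      have "\<sigma> (\<Prod>a\<in>A. poly h a) = (\<Prod>a\<in>A. \<sigma> (poly h a))"
        using hK AK by (intro embedding_prod[OF K e[OF \<sigma>]]) auto
      also have "\<dots> = (\<Prod>a\<in>A. poly h (\<sigma> a))" using \<sigma>h[OF \<sigma> h] AK by (intro prod.cong) auto
      also have "\<dots> = (\<Prod>a\<in>\<sigma> ` A. poly h a)" using injA[OF \<sigma>] by (simp add: prod.reindex)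
      finally show "\<sigma> (\<Prod>a\<in>A. poly h a) = (\<Prod>a\<in>A. poly h a)" using \<sigma>A_eq[OF \<sigma>] by simp
    qed
    fix a' assume ex: "\<exists>a\<in>A. poly h a = 0" and a': "a' \<in> A"
    then obtain a where a: "a \<in> A" "poly h a = 0" by blast
    obtain \<sigma> where \<sigma>: "\<sigma> \<in> G" "\<sigma> a = a'" using transA[OF a(1) a'] by blast
    show "poly h a' = 0"
      using \<sigma>h[OF \<sigma>(1) h, of a] a AK \<sigma>(2) embedding_0[OF K e[OF \<sigma>(1)]] by auto
  qed
  define b where "b j = (\<lambda>a\<in>A. c j (blk a))" for j
  have b_int: "b j \<in> integers_on A" for j
  proof -
    \<comment> \<open>This interpolating polynomial has coefficients in \<open>K\<close> at first.
      An automorphism permutes \<open>A\<close> and the blocks compatibly, so the image of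
      \<open>h\<close> interpolates the same data; by uniqueness \<open>h\<close> is invariant,
      hence rational.\<close>
    obtain h where h: "h \<in> polys_over K" "\<forall>i\<ge>card A. coeff h i = 0" "\<forall>a\<in>A. poly h a = c j (blk a)"
      using interpolation_over[OF K finA AK, of "\<lambda>a. c j (blk a)"] cK blkP by blast
    have inv: "map_poly \<sigma> h = h" if \<sigma>: "\<sigma> \<in> G" for \<sigma>
    proof (rule poly_eq_if_agree[OF finA])
      show "coeff (map_poly \<sigma> h) i = 0" if "i \<ge> card A" for i
        using h(2) that coeff_map_embedding[OF K e[OF \<sigma>]] embedding_0[OF K e[OF \<sigma>]] by simp
      show "coeff h i = 0" if "i \<ge> card A" for i using h(2) that by simp
      fix a assume "a \<in> A"
      then obtain a0 where a0: "a0 \<in> A" "a = \<sigma> a0" using \<sigma>A_eq[OF \<sigma>] by blast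
      have "poly (map_poly \<sigma> h) a = \<sigma> (poly h a0)"
        using poly_map_embedding[OF K e[OF \<sigma>] h(1), of a0] a0 AK by auto
      also have "\<dots> = c j (\<sigma> ` blk a0)" using h(3) a0 \<sigma>c[OF \<sigma> blkP[OF a0(1)]] by simp
      also have "\<dots> = poly h a" using h(3) \<sigma>blk[OF \<sigma> a0(1)] \<open>a \<in> A\<close> a0 by simp
      finally show "poly (map_poly \<sigma> h) a = poly h a" .
    qed
    have "coeff h i \<in> \<rat>" for i
    proof (rule fixedQ)
      show "coeff h i \<in> K" using h(1) by (simp add: polys_over_def)
      show "\<sigma> (coeff h i) = coeff h i" if "\<sigma> \<in> G" for \<sigma>
        using coeff_map_embedding[OF K e[OF that], of h i] inv[OF that] by simp
    qed
    then have "h \<in> polys_over \<rat>" by (simp add: polys_over_def)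
    moreover have "\<forall>a\<in>A. b j a = poly h a" using h(3) by (simp add: b_def)
    moreover have "\<forall>a\<in>A. algebraic_int (b j a)" using alg_c blkP by (simp add: b_def)
    ultimately show ?thesis unfolding integers_on_def by (auto simp: b_def)
  qed
  \<comment> \<open>One size for all coefficients of a block factor. Sizes multiply over the blocks
    to the product over all roots, which \<open>prod_roots_le\<close> controls.\<close>
  define M where "M a = (\<Prod>r\<in>blk a. 1 + cmod r)" for a
  have M1: "1 \<le> M a" for a unfolding M_def by (rule prod_ge_1) simp
  have Mcnj: "M (cnj a) = M a" if a: "a \<in> A" for a
  proof -
    have aK: "a \<in> K" using a AK by blast
    have BK: "blk a \<subseteq> K" using BR[OF blkP[OF a]] RK by blast
    have "restrict cnj K ` blk a = cnj ` blk a" using BK by (intro image_cong) auto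
    then have "blk (cnj a) = cnj ` blk a" using \<sigma>blk[OF cnjG a] aK by simp
    then show ?thesis by (simp add: M_def prod.reindex inj_on_def)
  qed
  have Mb: "cmod (b j a) \<le> M a" if "a \<in> A" for j a
    using norm_coeff_prod_linear_le[OF finB[OF blkP[OF that]], of j] that by (simp add: b_def c_def g_def M_def)
  have "(\<Prod>a\<in>A. M a) = (\<Prod>B\<in>P. \<Prod>r\<in>B. 1 + cmod r)"
    unfolding M_def by (rule prod.reindex_bij_betw[OF bijA])
  also have "\<dots> = (\<Prod>r\<in>\<Union>P. 1 + cmod r)"
    using finB disj by (intro prod.Union_disjoint[unfolded o_def, symmetric]) (auto simp: pairwise_def disjnt_def)
  also have "\<dots> \<le> 192 * H" unfolding UP by (rule prod_roots_le[OF H deg coef finR PR])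
  finally have MH: "(\<Prod>a\<in>A. M a) \<le> 192 * H" .
  have "map_poly of_int f = (\<Prod>a\<in>A. g (blk a))"
    unfolding Pg by (rule prod.reindex_bij_betw[OF bijA, symmetric])
  also have "\<dots> = (\<Prod>a\<in>A. monom 1 d + (\<Sum>j<d. monom (b j a) j))"
    using g_eq blkP by (intro prod.cong) (simp_all add: b_def)
  finally have fact: "map_poly of_int f = (\<Prod>a\<in>A. monom 1 d + (\<Sum>j<d. monom (b j a) j))" .
  have cardA: "card A * d = 6" using cardP bij_betw_same_card[OF bijA] by simp
  have "\<exists>j<d. \<forall>a\<in>A. b j a = a" using j0(1) c_blk by (intro exI[of _ j0]) (simp add: b_def)
  then show ?thesis
    using d cardA conj b_int fact M1 Mcnj Mb MH by (intro exI[of _ d] exI[of _ A] exI[of _ b] exI[of _ M]) blast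
qed

section \<open>Counting\<close>

text \<open>
  Complex conjugation acts on the tuples, so that a tuple has only \<open>card A\<close> real coordinates; this
  is what makes the bound linear in the product of the \<open>Y a\<close>.
\<close>

lemma card_integers_on_le:
  assumes A: "conjugate_set A" "A \<noteq> {}"
    and Y: "\<And>a. a \<in> A \<Longrightarrow> 1 \<le> Y a" "\<And>a. a \<in> A \<Longrightarrow> Y (cnj a) = Y a"
  defines "T \<equiv> {\<beta> \<in> integers_on A. \<forall>a\<in>A. cmod (\<beta> a) \<le> Y a}"
  shows "finite T" and "real (card T) \<le> 7 ^ card A * (\<Prod>a\<in>A. Y a)"
proof -
  have fin: "finite A" and cnjA: "\<And>a. a \<in> A \<Longrightarrow> cnj a \<in> A" using A(1) by (auto simp: conjugate_set_def)
  define m where "m = card A"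
  have m: "m > 0" using fin A(2) by (simp add: m_def card_gt_0_iff)
  have Y1: "1 \<le> (\<Prod>a\<in>A. Y a)" using Y(1) by (rule prod_ge_1)
  \<comment> \<open>\<open>Q\<close> is the geometric mean of the \<open>Y a\<close>. The box is cut
    into cells of its own shape with sides \<open>s a\<close>, scaled so that the product of the
    \<open>2 * s a\<close> equals 1, the threshold set by the norm.\<close>
  define Q where "Q = root m (\<Prod>a\<in>A. Y a)"
  have Qm: "Q ^ m = (\<Prod>a\<in>A. Y a)" unfolding Q_def using m Y1 by simp
  have Q1: "1 \<le> Q" unfolding Q_def using m Y1 by simp
  define s where "s a = Y a / (2 * Q)" for a
  have s0: "0 < s a" if "a \<in> A" for a unfolding s_def using Y(1)[OF that] Q1 by simp
  have s_cnj: "s (cnj a) = s a" if "a \<in> A" for a unfolding s_def using Y(2)[OF that] by simp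
  have prod_s: "(\<Prod>a\<in>A. 2 * s a) = 1"
  proof -
    have "(\<Prod>a\<in>A. 2 * s a) = (\<Prod>a\<in>A. Y a / Q)" by (simp add: s_def)
    also have "\<dots> = (\<Prod>a\<in>A. Y a) / Q ^ m" by (simp add: prod_dividef m_def)
    finally show ?thesis using Qm Y1 by simp
  qed
  \<comment> \<open>One real coordinate per element of \<open>A\<close>: the real part at a real
    element, and at a conjugate pair the real part at one element and the imaginary part at the
    other.\<close>
  define y where "y \<beta> a = (if Im a \<ge> 0 then Re (\<beta> a) else Im (\<beta> a))" for \<beta> :: "complex \<Rightarrow> complex" and a
  define \<Phi> where "\<Phi> \<beta> = (\<lambda>a\<in>A. \<lfloor>y \<beta> a / s a\<rfloor>)" for \<beta>
  define N where "N = \<lceil>2 * Q\<rceil>"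
  have im: "\<Phi> ` T \<subseteq> PiE A (\<lambda>_. {-N..N})"
  proof (intro image_subsetI PiE_I)
    fix \<beta> a assume \<beta>: "\<beta> \<in> T" and a: "a \<in> A"
    have "\<bar>y \<beta> a\<bar> \<le> cmod (\<beta> a)" by (simp add: y_def abs_Re_le_cmod abs_Im_le_cmod)
    also have "\<dots> \<le> Y a" using \<beta> a by (simp add: T_def)
    also have "\<dots> = 2 * Q * s a" using Q1 by (simp add: s_def)
    finally have "\<bar>y \<beta> a / s a\<bar> \<le> 2 * Q" using s0[OF a] by (simp add: field_simps)
    then have "\<bar>y \<beta> a / s a\<bar> \<le> of_int N" unfolding N_def by linarith
    then show "\<Phi> \<beta> a \<in> {-N..N}" using a by (simp add: \<Phi>_def; linarith)
  qed (simp add: \<Phi>_def)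
  have inj: "inj_on \<Phi> T"
  proof (rule inj_onI, rule ccontr)
    fix \<beta> \<gamma> assume \<beta>: "\<beta> \<in> T" and \<gamma>: "\<gamma> \<in> T" and eq: "\<Phi> \<beta> = \<Phi> \<gamma>" and ne: "\<beta> \<noteq> \<gamma>"
    have ints: "\<beta> \<in> integers_on A" "\<gamma> \<in> integers_on A" using \<beta> \<gamma> by (auto simp: T_def)
    define \<delta> where "\<delta> a = \<beta> a - \<gamma> a" for a
    have \<delta>_cnj: "\<delta> (cnj a) = cnj (\<delta> a)" if "a \<in> A" for a
      using integers_on_cnj[OF A(1) ints(1) that] integers_on_cnj[OF A(1) ints(2) that] by (simp add: \<delta>_def)
    have y_less: "\<bar>if Im a \<ge> 0 then Re (\<delta> a) else Im (\<delta> a)\<bar> < s a" if a: "a \<in> A" for a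
    proof -
      have "\<lfloor>y \<beta> a / s a\<rfloor> = \<lfloor>y \<gamma> a / s a\<rfloor>" using fun_cong[OF eq, of a] a by (simp add: \<Phi>_def)
      then have "\<bar>y \<beta> a / s a - y \<gamma> a / s a\<bar> < 1" by linarith
      then have "\<bar>(y \<beta> a - y \<gamma> a) / s a\<bar> < 1" by (simp add: diff_divide_distrib)
      then have "\<bar>y \<beta> a - y \<gamma> a\<bar> < s a" using s0[OF a] by (simp add: abs_divide)
      then show ?thesis by (auto simp: y_def \<delta>_def split: if_splits)
    qed
    \<comment> \<open>Within a cell each coordinate differs by less than \<open>s a\<close>. At a
      conjugate pair the two coordinates bound real and imaginary part of \<open>\<delta> a\<close>,
      and \<open>s\<close> agrees on the pair; at a real element the imaginary part
      vanishes.\<close>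
    have less: "cmod (\<delta> a) < 2 * s a" if a: "a \<in> A" for a
    proof -
      consider "Im a = 0" | "Im a > 0" | "Im a < 0" by linarith
      then have "\<bar>Re (\<delta> a)\<bar> + \<bar>Im (\<delta> a)\<bar> < 2 * s a"
      proof cases
        case 1
        then have "cnj a = a" by (simp add: complex_eq_iff)
        then have "Im (\<delta> a) = 0" using \<delta>_cnj[OF a] by (metis cnj.sel(2) equal_neg_zero)
        then show ?thesis using y_less[OF a] 1 s0[OF a] by simp
      next
        case 2
        then show ?thesis
          using y_less[OF a] y_less[OF cnjA[OF a]] \<delta>_cnj[OF a] s_cnj[OF a] by simp
      next
        case 3
        then show ?thesis
          using y_less[OF a] y_less[OF cnjA[OF a]] \<delta>_cnj[OF a] s_cnj[OF a] by simp
      qed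
      then show ?thesis using cmod_le[of "\<delta> a"] by linarith
    qed
    obtain a0 where a0: "a0 \<in> A" using A(2) by blast
    have "(\<Prod>a\<in>A. cmod (\<delta> a)) < (\<Prod>a\<in>A. 2 * s a)"
      using less s0 fin less_imp_le[OF less] by (intro prod_mono_strict[of a0 A]) (use a0 in auto)
    \<comment> \<open>Two distinct tuples in one cell would have a difference of norm below
      1.\<close>
    then show False using integers_on_separated[OF A(1) ints ne] prod_s by (simp add: \<delta>_def)
  qed
  have finP: "finite (PiE A (\<lambda>_. {-N..N}))" using fin by (intro finite_PiE) auto
  show "finite T" using finite_subset[OF im finP] inj finite_image_iff by blast
  have "N \<ge> 0" unfolding N_def using Q1 by simp
  have "card T \<le> card (PiE A (\<lambda>_. {-N..N}))" using card_inj_on_le[OF inj im finP] .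
  also have "\<dots> = nat (2 * N + 1) ^ m" using fin by (simp add: card_PiE m_def)
  finally have "real (card T) \<le> real (nat (2 * N + 1) ^ m)" by (rule of_nat_mono)
  also have "\<dots> = real (nat (2 * N + 1)) ^ m" by simp
  also have "real (nat (2 * N + 1)) = 2 * of_int N + 1" using \<open>N \<ge> 0\<close> by simp
  \<comment> \<open>Origin of the 7: \<open>2 * N + 1 \<le> 4 * Q + 3 \<le> 7 * Q\<close>, as
    \<open>Q \<ge> 1\<close>.\<close>
  also have "(2 * of_int N + 1) ^ m \<le> (7 * Q) ^ m"
  proof (rule power_mono)
    have "of_int N \<le> 2 * Q + 1" unfolding N_def by linarith
    then show "2 * of_int N + 1 \<le> 7 * Q" using Q1 by simp
  qed (use \<open>N \<ge> 0\<close> in simp)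
  also have "\<dots> = 7 ^ m * (\<Prod>a\<in>A. Y a)" by (simp add: power_mult_distrib Qm)
  finally show "real (card T) \<le> 7 ^ card A * (\<Prod>a\<in>A. Y a)" by (simp add: m_def)
qed

text \<open>A set \<open>A\<close> is recovered as the root set of its monic integer polynomial, and
  each of the \<open>m\<close> lower coefficients of that polynomial is bounded by \<open>L\<close>,
  which leaves at most \<open>2 * L + 1 \<le> 3 * L\<close> values.\<close>

lemma card_conjugate_sets_le:
  fixes L :: real and m :: nat
  assumes L: "L \<ge> 1"
  defines "\<A> \<equiv> {A. conjugate_set A \<and> card A = m \<and> (\<Prod>a\<in>A. 1 + cmod a) \<le> L}"
  shows "finite \<A>" and "real (card \<A>) \<le> (3 * L) ^ m"
proof -
  define q where "q A = (\<Prod>a\<in>A. [:- a, 1:])" for A :: "complex set"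
  define \<Phi> where "\<Phi> A = (\<lambda>i\<in>{..<m}. \<lfloor>Re (coeff (q A) i)\<rfloor>)" for A
  define N where "N = \<lfloor>L\<rfloor>"
  have fin: "finite A" if "A \<in> \<A>" for A using that by (simp add: \<A>_def conjugate_set_def)
  have int: "coeff (q A) i = of_int \<lfloor>Re (coeff (q A) i)\<rfloor>" if "A \<in> \<A>" for A i
  proof -
    have "coeff (q A) i \<in> \<int>" using that by (auto simp: \<A>_def conjugate_set_def q_def polys_over_def)
    then show ?thesis by (auto elim!: Ints_cases)
  qed
  have im: "\<Phi> ` \<A> \<subseteq> PiE {..<m} (\<lambda>_. {-N..N})"
  proof (intro image_subsetI PiE_I)
    fix A i assume A: "A \<in> \<A>" and i: "i \<in> {..<m}"
    have "cmod (coeff (q A) i) \<le> (\<Prod>a\<in>A. 1 + cmod a)"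
      unfolding q_def by (rule norm_coeff_prod_linear_le[OF fin[OF A]])
    also have "\<dots> \<le> L" using A by (simp add: \<A>_def)
    finally have "\<bar>real_of_int \<lfloor>Re (coeff (q A) i)\<rfloor>\<bar> \<le> L" by (subst (asm) int[OF A]) simp
    then have "\<bar>\<lfloor>Re (coeff (q A) i)\<rfloor>\<bar> \<le> N" unfolding N_def by linarith
    then show "\<Phi> A i \<in> {-N..N}" using i by (simp add: \<Phi>_def abs_le_iff)
  qed (simp add: \<Phi>_def)
  have deg: "degree (q A) = m" "lead_coeff (q A) = 1" if "A \<in> \<A>" for A
  proof -
    show "degree (q A) = m"
      unfolding q_def using that by (subst degree_prod_eq_sum_degree) (auto simp: \<A>_def)
    show "lead_coeff (q A) = 1" unfolding q_def by (simp only: lead_coeff_prod) simp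
  qed
  have inj: "inj_on \<Phi> \<A>"
  proof (rule inj_onI)
    fix A B assume A: "A \<in> \<A>" and B: "B \<in> \<A>" and eq: "\<Phi> A = \<Phi> B"
    have "coeff (q A) i = coeff (q B) i" if "i < m" for i
      using fun_cong[OF eq, of i] that int[OF A, of i] int[OF B, of i] by (simp add: \<Phi>_def)
    then have "q A = q B"
      using monic_eq_sum_monom[OF deg[OF A]] monic_eq_sum_monom[OF deg[OF B]]
      by (metis (no_types, lifting) lessThan_iff sum.cong)
    moreover have "{z. poly (q C) z = 0} = C" if "C \<in> \<A>" for C
      using fin[OF that] by (auto simp: q_def poly_prod)
    ultimately show "A = B" using A B by metis
  qed
  have finP: "finite (PiE {..<m} (\<lambda>_. {-N..N}))" by (intro finite_PiE) auto
  show "finite \<A>" using finite_subset[OF im finP] inj finite_image_iff by blast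
  have "N \<ge> 0" unfolding N_def using L by simp
  have "card \<A> \<le> card (PiE {..<m} (\<lambda>_. {-N..N}))" using card_inj_on_le[OF inj im finP] .
  also have "\<dots> = nat (2 * N + 1) ^ m" by (simp add: card_PiE)
  finally have "real (card \<A>) \<le> real (nat (2 * N + 1) ^ m)" by (rule of_nat_mono)
  also have "\<dots> = real (nat (2 * N + 1)) ^ m" by simp
  also have "real (nat (2 * N + 1)) = 2 * of_int N + 1" using \<open>N \<ge> 0\<close> by simp
  also have "(2 * of_int N + 1) ^ m \<le> (3 * L) ^ m"
  proof (rule power_mono)
    have "of_int N \<le> L" unfolding N_def by linarith
    then show "2 * of_int N + 1 \<le> 3 * L" using L by simp
  qed (use \<open>N \<ge> 0\<close> in simp)
  finally show "real (card \<A>) \<le> (3 * L) ^ m" .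
qed

section \<open>Sextics assembled from block data\<close>

lemma card_UN_le_mult:
  assumes "finite I" "\<And>i. i \<in> I \<Longrightarrow> real (card (F i)) \<le> c"
  shows "real (card (\<Union>i\<in>I. F i)) \<le> real (card I) * c"
proof -
  have "real (card (\<Union>i\<in>I. F i)) \<le> real (\<Sum>i\<in>I. card (F i))" using card_UN_le[OF assms(1)] by (simp only: of_nat_le_iff)
  also have "\<dots> \<le> (\<Sum>i\<in>I. c)" unfolding of_nat_sum by (rule sum_mono) (rule assms(2))
  finally show ?thesis by simp
qed

text \<open>Inverts the factorization along blocks. The slot \<open>j0\<close> is filled by the
  generator itself, so only the other coefficients remain to be supplied.\<close>

definition assemble :: "nat \<Rightarrow> nat \<Rightarrow> complex set \<Rightarrow> (nat \<Rightarrow> complex \<Rightarrow> complex) \<Rightarrow> complex poly" where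
  "assemble e j0 A b = (\<Prod>a\<in>A. monom 1 e + (\<Sum>j<e. monom (if j = j0 then a else b j a) j))"

text \<open>The sizes \<open>k\<close> are fixed before the coefficients, so that all coefficients
  lie in one common box, and they are symmetric under conjugation as the count of integers requires.
  A polynomial may arise repeatedly; only an upper bound is wanted.\<close>

definition assembled :: "nat \<Rightarrow> nat \<Rightarrow> nat \<Rightarrow> real \<Rightarrow> complex poly set" where
  "assembled m e n L =
     (\<Union>A\<in>{A. conjugate_set A \<and> card A = m \<and> (\<Prod>a\<in>A. 1 + cmod a) \<le> L}.
      \<Union>k\<in>{k \<in> PiE A (\<lambda>_. {..n}). (\<forall>a\<in>A. k (cnj a) = k a) \<and> (\<Prod>a\<in>A. 2 ^ k a) \<le> L}.
      \<Union>j0\<in>{..<e}. assemble e j0 A `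
        PiE ({..<e} - {j0}) (\<lambda>_. {\<beta> \<in> integers_on A. \<forall>a\<in>A. cmod (\<beta> a) \<le> 2 ^ k a}))"

text \<open>The factors belong, in order, to the conjugate set, the size exponents, the slot of the
  generator and the \<open>e - 1\<close> free coefficients. Each free coefficient contributes only
  one factor \<open>L\<close>, because the product of the box sizes is at most \<open>L\<close>
  however they are distributed.\<close>

lemma assembled_bound:
  assumes L: "L \<ge> 1" and m: "m > 0"
  shows "finite (assembled m e n L)"
    and "real (card (assembled m e n L)) \<le>
           (3 * L) ^ m * (real (n + 1) ^ m * (real e * (7 ^ m * L) ^ (e - 1)))"
proof -
  let ?\<A> = "{A. conjugate_set A \<and> card A = m \<and> (\<Prod>a\<in>A. 1 + cmod a) \<le> L}"
  let ?\<K> = "\<lambda>A. {k \<in> PiE A (\<lambda>_. {..n}). (\<forall>a\<in>A. k (cnj a) = k a) \<and> (\<Prod>a\<in>A. 2 ^ k a) \<le> L}"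
  let ?T = "\<lambda>A k. {\<beta> \<in> integers_on A. \<forall>a\<in>A. cmod (\<beta> a) \<le> 2 ^ k a}"
  note fin\<A> = card_conjugate_sets_le[OF L, of m]
  have T: "finite (?T A k)" "real (card (?T A k)) \<le> 7 ^ m * L" if A: "A \<in> ?\<A>" and k: "k \<in> ?\<K> A" for A k
  proof -
    have c: "conjugate_set A" "A \<noteq> {}" "card A = m" using A m by auto
    have k1: "(1::real) \<le> 2 ^ k a" for a by simp
    have k2: "(2::real) ^ k (cnj a) = 2 ^ k a" if "a \<in> A" for a using k that by simp
    note b = card_integers_on_le[OF c(1,2), of "\<lambda>a. 2 ^ k a", OF k1 k2]
    show "finite (?T A k)" by (rule b(1))
    have "real (card (?T A k)) \<le> 7 ^ m * (\<Prod>a\<in>A. 2 ^ k a)" using b(2) c(3) by simp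
    also have "\<dots> \<le> 7 ^ m * L" using k by (intro mult_left_mono) auto
    finally show "real (card (?T A k)) \<le> 7 ^ m * L" .
  qed
  have fin\<K>: "finite (?\<K> A)" "real (card (?\<K> A)) \<le> real (n + 1) ^ m" if A: "A \<in> ?\<A>" for A
  proof -
    have fA: "finite A" "card A = m" using A by (auto simp: conjugate_set_def)
    have fP: "finite (PiE A (\<lambda>_. {..n}))" using fA by (intro finite_PiE) auto
    then show "finite (?\<K> A)" by (rule rev_finite_subset) auto
    have "card (?\<K> A) \<le> card (PiE A (\<lambda>_. {..n}))" using fP by (intro card_mono) auto
    also have "\<dots> = (n + 1) ^ m" using fA by (simp add: card_PiE)
    finally have "real (card (?\<K> A)) \<le> real ((n + 1) ^ m)" by (rule of_nat_mono)
    then show "real (card (?\<K> A)) \<le> real (n + 1) ^ m" by simp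
  qed
  have leaf: "finite (assemble e j0 A ` PiE ({..<e} - {j0}) (\<lambda>_. ?T A k))"
      "real (card (assemble e j0 A ` PiE ({..<e} - {j0}) (\<lambda>_. ?T A k))) \<le> (7 ^ m * L) ^ (e - 1)"
    if A: "A \<in> ?\<A>" and k: "k \<in> ?\<K> A" and j0: "j0 \<in> {..<e}" for A k j0
  proof -
    have fP: "finite (PiE ({..<e} - {j0}) (\<lambda>_. ?T A k))" using T(1)[OF A k] by (intro finite_PiE) auto
    then show "finite (assemble e j0 A ` PiE ({..<e} - {j0}) (\<lambda>_. ?T A k))" by (rule finite_imageI)
    have "card (assemble e j0 A ` PiE ({..<e} - {j0}) (\<lambda>_. ?T A k)) \<le> card (PiE ({..<e} - {j0}) (\<lambda>_. ?T A k))"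
      by (rule card_image_le[OF fP])
    also have "\<dots> = card (?T A k) ^ (e - 1)" using j0 by (simp add: card_PiE)
    finally have "real (card (assemble e j0 A ` PiE ({..<e} - {j0}) (\<lambda>_. ?T A k))) \<le> real (card (?T A k) ^ (e - 1))"
      by (rule of_nat_mono)
    also have "\<dots> = real (card (?T A k)) ^ (e - 1)" by simp
    also have "\<dots> \<le> (7 ^ m * L) ^ (e - 1)" using T(2)[OF A k] by (intro power_mono) auto
    finally show "real (card (assemble e j0 A ` PiE ({..<e} - {j0}) (\<lambda>_. ?T A k))) \<le> (7 ^ m * L) ^ (e - 1)" .
  qed
  show "finite (assembled m e n L)"
    unfolding assembled_def by (intro finite_UN_I fin\<A>(1) fin\<K>(1) leaf(1)) auto
  have L0: "0 \<le> (7 ^ m * L) ^ (e - 1)" using L by simp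
  have b1: "real (card (\<Union>j0\<in>{..<e}. assemble e j0 A ` PiE ({..<e} - {j0}) (\<lambda>_. ?T A k)))
      \<le> real e * (7 ^ m * L) ^ (e - 1)" if "A \<in> ?\<A>" "k \<in> ?\<K> A" for A k
    using card_UN_le_mult[OF finite_lessThan leaf(2)[OF that]] by simp
  have b2: "real (card (\<Union>k\<in>?\<K> A. \<Union>j0\<in>{..<e}. assemble e j0 A ` PiE ({..<e} - {j0}) (\<lambda>_. ?T A k)))
      \<le> real (n + 1) ^ m * (real e * (7 ^ m * L) ^ (e - 1))" if A: "A \<in> ?\<A>" for A
    by (rule order_trans[OF card_UN_le_mult[OF fin\<K>(1)[OF A] b1[OF A]] mult_right_mono[OF fin\<K>(2)[OF A]]])
       (use L0 in \<open>simp_all add: mult_nonneg_nonneg\<close>)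
  show "real (card (assembled m e n L)) \<le>
      (3 * L) ^ m * (real (n + 1) ^ m * (real e * (7 ^ m * L) ^ (e - 1)))"
    unfolding assembled_def
    by (rule order_trans[OF card_UN_le_mult[OF fin\<A>(1) b2] mult_right_mono[OF fin\<A>(2)]])
       (use L0 in \<open>simp_all add: mult_nonneg_nonneg\<close>)
qed

text \<open>Rounding up leaves finitely many sizes at the price of a factor 2;
  \<open>1 \<le> x\<close> makes the exponent a natural number.\<close>

lemma dyadic_bound:
  assumes "1 \<le> (x :: real)"
  defines "k \<equiv> nat \<lceil>log 2 x\<rceil>"
  shows "x \<le> 2 ^ k" "2 ^ k \<le> 2 * x"
proof -
  have l: "0 \<le> log 2 x" using assms(1) by simp
  then have k: "real k = of_int \<lceil>log 2 x\<rceil>" by (simp add: k_def)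
  have pow_log: "2 powr log 2 x = x" using assms(1) by simp
  have "2 powr log 2 x \<le> 2 powr real k" unfolding k by (intro powr_mono) linarith+
  then show "x \<le> 2 ^ k" unfolding pow_log by (simp add: powr_realpow)
  have "2 ^ k = 2 powr real k" by (simp add: powr_realpow)
  also have "\<dots> \<le> 2 powr (1 + log 2 x)" unfolding k by (intro powr_mono) linarith+
  also have "\<dots> = 2 * 2 powr log 2 x" by (simp add: powr_add)
  also have "\<dots> = 2 * x" unfolding pow_log by (rule refl)
  finally show "2 ^ k \<le> 2 * x" .
qed

text \<open>\<open>1536 = 2 ^ 3 * 192\<close>: at each of at most three places, rounding
  \<open>M a\<close> to a power of 2 costs a factor 2, and \<open>1 + cmod a \<le> 2 * M a\<close>
  fits the same allowance.\<close>

lemma solvable_sextic_assembled: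
  assumes f: "f \<in> solvable_sextics H" and H: "H \<ge> 1"
  shows "map_poly of_int f \<in> assembled 3 2 (nat \<lceil>log 2 (192 * H)\<rceil>) (1536 * H) \<union>
      assembled 2 3 (nat \<lceil>log 2 (192 * H)\<rceil>) (1536 * H)"
proof -
  obtain e A b M where *: "(e = 2 \<or> e = 3) \<and> card A * e = 6 \<and> conjugate_set A \<and>
    (\<forall>j<e. b j \<in> integers_on A) \<and> (\<exists>j<e. \<forall>a\<in>A. b j a = a) \<and>
    map_poly of_int f = (\<Prod>a\<in>A. monom 1 e + (\<Sum>j<e. monom (b j a) j)) \<and>
    (\<forall>a\<in>A. 1 \<le> M a \<and> M (cnj a) = M a \<and> (\<forall>j<e. cmod (b j a) \<le> M a)) \<and> (\<Prod>a\<in>A. M a) \<le> 192 * H"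
    using solvable_sextic_factorization[OF f H] by (elim exE) (rule that)
  have e: "e = 2 \<or> e = 3" "card A * e = 6" and A: "conjugate_set A"
    and b: "\<And>j. j < e \<Longrightarrow> b j \<in> integers_on A"
    and fact: "map_poly of_int f = (\<Prod>a\<in>A. monom 1 e + (\<Sum>j<e. monom (b j a) j))"
    and M: "\<And>a. a \<in> A \<Longrightarrow> 1 \<le> M a" "\<And>a. a \<in> A \<Longrightarrow> M (cnj a) = M a"
      "\<And>a j. a \<in> A \<Longrightarrow> j < e \<Longrightarrow> cmod (b j a) \<le> M a"
    and MH: "(\<Prod>a\<in>A. M a) \<le> 192 * H"
    using * by simp_all
  obtain j0 where j0: "j0 < e" "\<And>a. a \<in> A \<Longrightarrow> b j0 a = a" using * by blast
  have fin: "finite A" using A by (simp add: conjugate_set_def)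
  have cnjA: "cnj a \<in> A" if "a \<in> A" for a using A that by (auto simp: conjugate_set_def)
  have card3: "card A \<le> 3" using e by auto
  have two: "(\<Prod>a\<in>A. 2 * M a) \<le> 1536 * H"
  proof -
    have "(\<Prod>a\<in>A. 2 * M a) = 2 ^ card A * (\<Prod>a\<in>A. M a)" by (simp add: prod.distrib)
    also have "\<dots> \<le> 2 ^ 3 * (192 * H)"
    proof (rule mult_mono)
      show "0 \<le> (\<Prod>a\<in>A. M a)" using prod_ge_1[of A M] M(1) by simp
      show "(2::real) ^ card A \<le> 2 ^ 3" by (rule power_increasing[OF card3]) simp
    qed (use MH in auto)
    finally show ?thesis by simp
  qed
  have size: "(\<Prod>a\<in>A. 1 + cmod a) \<le> 1536 * H"
  proof -
    have "1 + cmod a \<le> 2 * M a" if "a \<in> A" for a using M(1)[OF that] M(3)[OF that j0(1)] j0(2)[OF that] by simp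
    then have "(\<Prod>a\<in>A. 1 + cmod a) \<le> (\<Prod>a\<in>A. 2 * M a)" by (intro prod_mono) auto
    then show ?thesis using two by simp
  qed
  define n where "n = nat \<lceil>log 2 (192 * H)\<rceil>"
  define k where "k = (\<lambda>a\<in>A. nat \<lceil>log 2 (M a)\<rceil>)"
  have k: "M a \<le> 2 ^ k a" "2 ^ k a \<le> 2 * M a" if "a \<in> A" for a
    using dyadic_bound[OF M(1)[OF that]] that by (simp_all add: k_def)
  have "k \<in> PiE A (\<lambda>_. {..n})"
  proof (rule PiE_I)
    fix a assume a: "a \<in> A"
    \<comment> \<open>The other sizes are at least 1, so each single size is bounded by the product
      and its exponent by \<open>n\<close>.\<close>
    have "M a \<le> (\<Prod>a\<in>A. M a)"
    proof -
      have "1 \<le> (\<Prod>a\<in>A - {a}. M a)" using M(1) by (intro prod_ge_1) auto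
      then have "M a * 1 \<le> M a * (\<Prod>a\<in>A - {a}. M a)" using M(1)[OF a] by (intro mult_left_mono) auto
      then show ?thesis using prod.remove[OF fin a, of M] by simp
    qed
    then have "log 2 (M a) \<le> log 2 (192 * H)" using MH M(1)[OF a] H by simp
    then have "nat \<lceil>log 2 (M a)\<rceil> \<le> n" unfolding n_def by (intro nat_mono ceiling_mono)
    then show "k a \<in> {..n}" using a by (simp add: k_def)
  qed (simp add: k_def)
  moreover have "\<forall>a\<in>A. k (cnj a) = k a" using cnjA M(2) by (simp add: k_def)
  moreover have "(\<Prod>a\<in>A. 2 ^ k a) \<le> 1536 * H"
  proof -
    have "(\<Prod>a\<in>A. 2 ^ k a) \<le> (\<Prod>a\<in>A. 2 * M a)" using k(2) by (intro prod_mono) auto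
    then show ?thesis using two by simp
  qed
  moreover define c where "c = restrict b ({..<e} - {j0})"
  have "c \<in> PiE ({..<e} - {j0}) (\<lambda>_. {\<beta> \<in> integers_on A. \<forall>a\<in>A. cmod (\<beta> a) \<le> 2 ^ k a})"
    unfolding c_def using b order_trans[OF M(3) k(1)] by auto
  moreover have "map_poly of_int f = assemble e j0 A c"
    unfolding fact assemble_def
    by (intro prod.cong arg_cong2[where f = "(+)"] sum.cong) (auto simp: c_def j0(2))
  ultimately have "map_poly of_int f \<in> assembled (card A) e n (1536 * H)"
    unfolding assembled_def using A size j0(1) by blast
  moreover have "card A = 3 \<and> e = 2 \<or> card A = 2 \<and> e = 3" using e by auto
  ultimately show ?thesis unfolding n_def by auto
qed

lemma card_solvable_sextics_le:
  assumes H: "H \<ge> 1"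
  shows "real (card (solvable_sextics H)) \<le> 10 ^ 20 * (H ^ 4 * (log 2 (192 * H) + 2) ^ 3)"
proof -
  define n where "n = nat \<lceil>log 2 (192 * H)\<rceil>"
  define L where "L = 1536 * H"
  have L: "L \<ge> 1" using H by (simp add: L_def)
  define U where "U = assembled 3 2 n L \<union> assembled 2 3 n L"
  have finU: "finite U" unfolding U_def using assembled_bound(1)[OF L] by simp
  have "card (solvable_sextics H) \<le> card U"
  proof (rule card_inj_on_le[OF _ _ finU])
    show "inj_on (map_poly complex_of_int) (solvable_sextics H)"
      by (rule inj_onI, rule poly_eqI) (metis coeff_map_poly of_int_0 of_int_eq_iff)
    show "map_poly complex_of_int ` solvable_sextics H \<subseteq> U"
      using solvable_sextic_assembled[OF _ H] by (auto simp: U_def n_def L_def)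
  qed
  also have "\<dots> \<le> card (assembled 3 2 n L) + card (assembled 2 3 n L)" unfolding U_def by (rule card_Un_le)
  finally have "real (card (solvable_sextics H)) \<le> real (card (assembled 3 2 n L)) + real (card (assembled 2 3 n L))"
    using of_nat_mono[where 'a = real] by fastforce
  also have "\<dots> \<le> (3 * L) ^ 3 * (real (n + 1) ^ 3 * (2 * (7 ^ 3 * L))) +
      (3 * L) ^ 2 * (real (n + 1) ^ 2 * (3 * (7 ^ 2 * L) ^ 2))"
    using assembled_bound(2)[OF L, of 3 2 n] assembled_bound(2)[OF L, of 2 3 n] by simp
  \<comment> \<open>\<open>18522 = 3 ^ 3 * 2 * 7 ^ 3\<close> comes from three blocks of size 2, and
    \<open>64827 = 3 ^ 2 * 3 * 7 ^ 4\<close> from two blocks of size 3; \<open>83349\<close> below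
    is their sum.\<close>
  also have "\<dots> = L ^ 4 * (18522 * real (n + 1) ^ 3 + 64827 * real (n + 1) ^ 2)"
    by (simp add: power_mult_distrib algebra_simps power_numeral_reduce)
  also have "\<dots> \<le> L ^ 4 * (83349 * real (n + 1) ^ 3)"
  proof (rule mult_left_mono)
    have "real (n + 1) ^ 2 \<le> real (n + 1) ^ 3" by (rule power_increasing) auto
    then show "18522 * real (n + 1) ^ 3 + 64827 * real (n + 1) ^ 2 \<le> 83349 * real (n + 1) ^ 3" by linarith
  qed (use L in simp)
  \<comment> \<open>Of the summand 2, one half is the loss in the ceiling, the other accounts for
    the \<open>n + 1\<close> exponents from 0 to \<open>n\<close>.\<close>
  also have "\<dots> \<le> L ^ 4 * (83349 * (log 2 (192 * H) + 2) ^ 3)"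
  proof (intro mult_left_mono power_mono)
    have "0 \<le> log 2 (192 * H)" using H by simp
    then show "real (n + 1) \<le> log 2 (192 * H) + 2" unfolding n_def by linarith
  qed (use L in auto)
  also have "\<dots> = 1536 ^ 4 * 83349 * (H ^ 4 * (log 2 (192 * H) + 2) ^ 3)"
    by (simp add: L_def power_mult_distrib)
  \<comment> \<open>\<open>1536 ^ 4 * 83349\<close> is below \<open>5 * 10 ^ 17\<close>.\<close>
  also have "\<dots> \<le> 10 ^ 20 * (H ^ 4 * (log 2 (192 * H) + 2) ^ 3)"
    using H by (intro mult_right_mono mult_nonneg_nonneg zero_le_power) auto
  finally show ?thesis .
qed

theorem corollary1p11:
  shows "(\<lambda>H::real. real (card (solvable_sextics H))) \<in> O(\<lambda>H. H powr 4.82)"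
proof -
  have "(\<lambda>H::real. real (card (solvable_sextics H))) \<in> O(\<lambda>H. H ^ 4 * (log 2 (192 * H) + 2) ^ 3)"
  proof (rule bigoI)
    show "\<forall>\<^sub>F H in at_top. norm (real (card (solvable_sextics H))) \<le>
        10 ^ 20 * norm (H ^ 4 * (log 2 (192 * H) + 2) ^ 3)"
      using eventually_ge_at_top[of 1]
    proof eventually_elim
      case (elim H)
      have "0 \<le> H ^ 4 * (log 2 (192 * H) + 2) ^ 3" using elim by simp
      then show ?case using card_solvable_sextics_le[OF elim] by simp
    qed
  qed
  \<comment> \<open>The gap between the exponents 4 and 4.82 absorbs the cube of the
    logarithm.\<close>
  also have "(\<lambda>H::real. H ^ 4 * (log 2 (192 * H) + 2) ^ 3) \<in> O(\<lambda>H. H powr 4.82)"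
    by real_asymp
  finally show ?thesis .
qed

end
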